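(* If the Strong Exponential Time Hypothesis holds, then neither $t$-Robust 2-Club nor $t$-Hereditary 2-Club admits an algorithm running in time $(2-\epsilon)^{\ell}\cdot n^{O(1)}$ for any $\epsilon>0$, where $n$ is the number of vertices of the input graph and $\ell:=n-k$.
   Context: All graphs are simple and undirected. For a graph $G=(V,E)$ and $S\subseteq V$, $G[S]$ is the induced subgraph; $S$ is a 2-club if $G[S]$ has diameter at most two. $S$ is a $t$-robust 2-club if every pair of vertices of $S$ is connected in $G[S]$ by $t$ internally vertex-disjoint paths of length at most two. $S$ is a $t$-hereditary 2-club if $G[S\setminus U]$ is a 2-club for every $U\subset S$ with $|U|\le t$. The problems $t$-Robust / $t$-Hereditary 2-Club take as input an undirected graph $G$ and nonnegative integers $t$ and $k$ and ask whether $G$ contains a $t$-robust / $t$-hereditary 2-club of size at least $k$. The Strong Exponential Time Hypothesis (SETH) postulates that CNF-SAT (satisfiability of Boolean formulas in conjunctive normal form) cannot be solved in time $(2-\epsilon)^N\cdot|F|^{O(1)}$ for any $\epsilon>0$, where $N$ is the number of variables and $|F|$ the size of the formula $F$. *)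

theory Defs
  imports "Graph_Theory.Graph_Theory" "HOL-Library.Log_Nat"
begin

section \<open>Robust and hereditary 2-clubs\<close>

text \<open>
  As usual in \<^theory>\<open>Graph_Theory.Graph_Theory\<close>, an undirected simple graph is a finite,
  symmetric, loop-free digraph without parallel arcs.
\<close>

definition diameter :: "('a, 'b) pre_digraph \<Rightarrow> ereal" where
  "diameter G = (SUP u\<in>verts G. SUP v\<in>verts G. wf_digraph.\<mu> G (\<lambda>_. 1) u v)"

definition two_club :: "('a, 'b) pre_digraph \<Rightarrow> 'a set \<Rightarrow> bool" where
  "two_club G S \<longleftrightarrow> S \<subseteq> verts G \<and> diameter (G \<restriction> S) \<le> 2"

definition internal_verts :: "'a list \<Rightarrow> 'a set" where
  "internal_verts p = set (butlast (tl p))"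

text \<open>
  The paths form a set, so the single-edge path, which has no internal vertices,
  contributes at most one of the required \<open>t\<close> paths.
\<close>

definition robust_two_club :: "('a, 'b) pre_digraph \<Rightarrow> nat \<Rightarrow> 'a set \<Rightarrow> bool" where
  "robust_two_club G t S \<longleftrightarrow> S \<subseteq> verts G \<and>
    (\<forall>u\<in>S. \<forall>v\<in>S. u \<noteq> v \<longrightarrow>
      (\<exists>P. finite P \<and> card P = t \<and>
        (\<forall>p\<in>P. vpath p (G \<restriction> S) \<and> hd p = u \<and> last p = v \<and> vwalk_length p \<le> 2) \<and>
        pairwise (\<lambda>p q. internal_verts p \<inter> internal_verts q = {}) P))"

definition hereditary_two_club :: "('a, 'b) pre_digraph \<Rightarrow> nat \<Rightarrow> 'a set \<Rightarrow> bool" where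
  "hereditary_two_club G t S \<longleftrightarrow> S \<subseteq> verts G \<and>
    (\<forall>U. U \<subset> S \<and> card U \<le> t \<longrightarrow> two_club G (S - U))"


section \<open>Random access machines with logarithmic cost\<close>

text \<open>
  Programs use finitely many registers and an unbounded memory, all holding natural numbers,
  with the operations of the Cook-Reckhow RAM: constants, addition, truncated subtraction and
  indirect access to the memory. Control flow is structured; jumps can be simulated
  by one loop around a case distinction over a program counter, at the price of a constant factor.
  Every step is charged the number of bits of the numbers and memory addresses it handles, so
  that unit-cost arithmetic on huge numbers cannot be used to speed up computations.
\<close>

datatype com =
    Const nat nat             \<comment> \<open>\<open>R x := c\<close>\<close>
  | Add nat nat nat           \<comment> \<open>\<open>R x := R y + R z\<close>\<close>
  | Sub nat nat nat           \<comment> \<open>\<open>R x := R y - R z\<close>\<close>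
  | Load nat nat              \<comment> \<open>\<open>R x := M (R y)\<close>\<close>
  | Store nat nat             \<comment> \<open>\<open>M (R x) := R y\<close>\<close>
  | Seq com com
  | IfNZ nat com com          \<comment> \<open>branch on \<open>R x \<noteq> 0\<close>\<close>
  | WhileNZ nat com           \<comment> \<open>loop while \<open>R x \<noteq> 0\<close>\<close>

type_synonym state = "(nat \<Rightarrow> nat) \<times> (nat \<Rightarrow> nat)"

abbreviation bits :: "nat \<Rightarrow> nat" where
  "bits n \<equiv> floorlog 2 n"

text \<open>\<open>exec p s n s'\<close>: started in \<open>s\<close>, program \<open>p\<close> terminates in \<open>s'\<close> at cost \<open>n\<close>.\<close>

inductive exec :: "com \<Rightarrow> state \<Rightarrow> nat \<Rightarrow> state \<Rightarrow> bool" where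
  Const: "exec (Const x c) (R, M) (1 + bits c) (R(x := c), M)"
| Add: "exec (Add x y z) (R, M) (1 + bits (R y) + bits (R z)) (R(x := R y + R z), M)"
| Sub: "exec (Sub x y z) (R, M) (1 + bits (R y) + bits (R z)) (R(x := R y - R z), M)"
| Load: "exec (Load x y) (R, M) (1 + bits (R y) + bits (M (R y))) (R(x := M (R y)), M)"
| Store: "exec (Store x y) (R, M) (1 + bits (R x) + bits (R y)) (R, M(R x := R y))"
| Seq: "exec p s n s' \<Longrightarrow> exec q s' m s'' \<Longrightarrow> exec (Seq p q) s (n + m) s''"
| IfTrue: "R x \<noteq> 0 \<Longrightarrow> exec p (R, M) n s' \<Longrightarrow>
    exec (IfNZ x p q) (R, M) (1 + bits (R x) + n) s'"
| IfFalse: "R x = 0 \<Longrightarrow> exec q (R, M) n s' \<Longrightarrow>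
    exec (IfNZ x p q) (R, M) (1 + bits (R x) + n) s'"
| WhileTrue: "R x \<noteq> 0 \<Longrightarrow> exec p (R, M) n s' \<Longrightarrow> exec (WhileNZ x p) s' m s'' \<Longrightarrow>
    exec (WhileNZ x p) (R, M) (1 + bits (R x) + n + m) s''"
| WhileFalse: "R x = 0 \<Longrightarrow> exec (WhileNZ x p) (R, M) (1 + bits (R x)) (R, M)"

text \<open>
  The input occupies the initial segment of the memory and its length is in register 0;
  everything else is 0. The answer is read off register 0.
\<close>

definition initial :: "nat list \<Rightarrow> state" where
  "initial xs = ((\<lambda>_. 0)(0 := length xs), (\<lambda>i. if i < length xs then xs ! i else 0))"

definition decides :: "com \<Rightarrow> 'i set \<Rightarrow> ('i \<Rightarrow> nat list) \<Rightarrow> ('i \<Rightarrow> bool) \<Rightarrow> bool" where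
  "decides p instances encode yes \<longleftrightarrow>
    (\<forall>I\<in>instances. \<exists>n s. exec p (initial (encode I)) n s \<and> (fst s 0 \<noteq> 0 \<longleftrightarrow> yes I))"

definition runs_within :: "com \<Rightarrow> nat list \<Rightarrow> real \<Rightarrow> bool" where
  "runs_within p xs b \<longleftrightarrow> (\<exists>n s. exec p (initial xs) n s \<and> real n \<le> b)"


section \<open>CNF-SAT and the Strong Exponential Time Hypothesis\<close>

datatype literal = Pos nat | Neg nat

type_synonym clause = "literal list"

text \<open>
  As in the DIMACS format, a formula \<open>(N, F)\<close> declares the number \<open>N\<close> of its variables, which are
  \<open>0, ..., N - 1\<close>.
\<close>

type_synonym cnf = "nat \<times> clause list"

fun var :: "literal \<Rightarrow> nat" where
  "var (Pos v) = v"
| "var (Neg v) = v"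

fun lit_true :: "(nat \<Rightarrow> bool) \<Rightarrow> literal \<Rightarrow> bool" where
  "lit_true \<sigma> (Pos v) = \<sigma> v"
| "lit_true \<sigma> (Neg v) = (\<not> \<sigma> v)"

definition cnf_instances :: "cnf set" where
  "cnf_instances = {(N, F). \<forall>C\<in>set F. \<forall>l\<in>set C. var l < N}"

definition satisfiable :: "cnf \<Rightarrow> bool" where
  "satisfiable \<phi> \<longleftrightarrow> (\<exists>\<sigma>. \<forall>C\<in>set (snd \<phi>). \<exists>l\<in>set C. lit_true \<sigma> l)"

fun lit_code :: "literal \<Rightarrow> nat" where
  "lit_code (Pos v) = 2 * v"
| "lit_code (Neg v) = 2 * v + 1"

fun cnf_encode :: "cnf \<Rightarrow> nat list" where
  "cnf_encode (N, F) = [N, length F] @ concat (map (\<lambda>C. length C # map lit_code C) F)"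

text \<open>
  The length of the encoding is 2 plus the number of clauses plus the number of literal
  occurrences; in particular it is positive.
\<close>

definition cnf_size :: "cnf \<Rightarrow> nat" where
  "cnf_size \<phi> = length (cnf_encode \<phi>)"

definition SETH :: bool where
  "SETH \<longleftrightarrow> \<not> (\<exists>\<epsilon>::real. \<epsilon> > 0 \<and>
    (\<exists>p. decides p cnf_instances cnf_encode satisfiable \<and>
      (\<exists>(C::real) (c::nat). \<forall>\<phi>\<in>cnf_instances.
        runs_within p (cnf_encode \<phi>) (C * (2 - \<epsilon>) ^ fst \<phi> * real (cnf_size \<phi>) ^ c))))"


section \<open>The problems \<open>t\<close>-Robust 2-Club and \<open>t\<close>-Hereditary 2-Club\<close>

type_synonym club_instance = "nat pair_pre_digraph \<times> nat \<times> nat"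

definition club_instances :: "club_instance set" where
  "club_instances = {(G, t, k). pair_graph G \<and> (\<exists>n. pverts G = {..<n})}"

fun adjacency_encode :: "club_instance \<Rightarrow> nat list" where
  "adjacency_encode (G, t, k) = (let n = card (pverts G) in
    [n, t, k] @ concat (map (\<lambda>u. map (\<lambda>v. if (u, v) \<in> parcs G then 1 else 0) [0..<n]) [0..<n]))"

fun robust_two_club_problem :: "club_instance \<Rightarrow> bool" where
  "robust_two_club_problem (G, t, k) \<longleftrightarrow>
    (\<exists>S. robust_two_club (with_proj G) t S \<and> card S \<ge> k)"

fun hereditary_two_club_problem :: "club_instance \<Rightarrow> bool" where
  "hereditary_two_club_problem (G, t, k) \<longleftrightarrow>
    (\<exists>S. hereditary_two_club (with_proj G) t S \<and> card S \<ge> k)"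

text \<open>
  The algorithm has to be correct on all inputs. The time bound is required for
  nonempty graphs and \<open>t, k \<le> n\<close>: for \<open>k > n\<close> the exponent \<open>n - k\<close> would be negative, for \<open>n = 0\<close>
  the polynomial factor would vanish, and for \<open>t > n\<close> the mere inspection of \<open>t\<close> need not be
  bounded in terms of \<open>n\<close>.
\<close>

definition solvable_in_time :: "(club_instance \<Rightarrow> bool) \<Rightarrow> real \<Rightarrow> bool" where
  "solvable_in_time problem b \<longleftrightarrow>
    (\<exists>p. decides p club_instances adjacency_encode problem \<and>
      (\<exists>(C::real) (c::nat). \<forall>(G, t, k)\<in>club_instances. let n = card (pverts G) in
        n \<ge> 1 \<and> t \<le> n \<and> k \<le> n \<longrightarrow>
          runs_within p (adjacency_encode (G, t, k)) (C * b ^ (n - k) * real n ^ c)))"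

end

theory Submission
  imports Defs
begin

text \<open>
  A 1-robust 2-club and a 0-hereditary 2-club are both just a 2-club, so it suffices to reduce
  CNF-SAT with \<open>N\<close> variables in polynomial time to finding a 2-club that misses at most \<open>N\<close> vertices.
  The two literals of a variable are made non-adjacent without common neighbours, hence each of the
  \<open>N\<close> pairs loses a vertex and nothing else can be deleted: the surviving literals are a truth
  assignment. Every clause has two non-adjacent vertices whose only common neighbours are its
  literals, so both can stay iff a literal of the clause survives. All other pairs are brought to
  distance two by four hubs, indexed by the side of the literal and the side of the clause vertex,
  and by joining opposite sides of different variables or clauses. Complementary literals in one
  clause would be common neighbours of the two literals; they are left out, and the two vertices of
  such a clause are joined instead.

  The reduction is programmed in a language of expressions with bounded iteration whose values and
  evaluation costs are polynomially bounded. The factor polynomial in \<open>N\<close> is absorbed by slightly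
  increasing the base of the exponential.
\<close>

section \<open>Running times of RAM programs\<close>

text \<open>The reduction has to be carried out by an actual machine program, and the assumed
  algorithm is specified only on states of the form \<open>initial xs\<close>; the transducer must
  therefore end in exactly such a state, with every scratch register and every leftover memory cell
  reset to 0. Its running time is polynomial in \<open>2 * N + cnf_size \<phi> + 2\<close> and not
  in \<open>cnf_size \<phi>\<close> alone, because \<open>N\<close> is a single entry of the
  encoding and may be far larger than the length; this is where the factor polynomial in
  \<open>N\<close> comes from. For \<open>m\<close> clauses the gadget graph has
  \<open>2 * N + 2 * m + 4\<close> vertices (two per variable, two per clause, four hubs) and the
  target size is \<open>N + 2 * m + 4\<close>, so the parameter n - k is exactly \<open>N\<close>.
  The constants of the assumed algorithm are unknown reals: its base \<open>2 - \<epsilon>\<close>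
  may lie below 1, and the signs of base and factor have to be read off from the time bound
  itself.\<close>

definition steps :: "com \<Rightarrow> state \<Rightarrow> nat \<Rightarrow> state \<Rightarrow> bool" where
  "steps p s T s' \<longleftrightarrow> (\<exists>n\<le>T. exec p s n s')"

text \<open>Bounding a bit length by the number itself is very wasteful, but every number that
  occurs below is polynomially bounded, so the costs stay polynomial.\<close>

lemma bits_le: "bits n \<le> n"
  by (rule floorlog_leI) (use less_exp in auto)

lemma steps_mono: "steps p s T s' \<Longrightarrow> T \<le> T' \<Longrightarrow> steps p s T' s'"
  unfolding steps_def using order_trans by blast

lemma steps_Const: "steps (Const x c) (R, M) (1 + c) (R(x := c), M)"
  unfolding steps_def using exec.Const bits_le by (meson add_left_mono)

lemma steps_Add: "steps (Add x y z) (R, M) (1 + R y + R z) (R(x := R y + R z), M)"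
  unfolding steps_def using exec.Add bits_le by (meson add_mono order_refl)

lemma steps_Sub: "steps (Sub x y z) (R, M) (1 + R y + R z) (R(x := R y - R z), M)"
  unfolding steps_def using exec.Sub bits_le by (meson add_mono order_refl)

lemma steps_Load: "steps (Load x y) (R, M) (1 + R y + M (R y)) (R(x := M (R y)), M)"
  unfolding steps_def using exec.Load bits_le by (meson add_mono order_refl)

lemma steps_Store: "steps (Store x y) (R, M) (1 + R x + R y) (R, M(R x := R y))"
  unfolding steps_def using exec.Store bits_le by (meson add_mono order_refl)

lemma steps_Seq:
  assumes "steps p s T s'" "steps q s' U s''"
  shows "steps (Seq p q) s (T + U) s''"
  using assms unfolding steps_def by (meson add_mono exec.Seq)

text \<open>One final state and one bound serve both branches: the outcome is described below as a
  conditional value, and \<open>T\<close> dominates both costs.\<close>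

lemma steps_IfNZ:
  assumes "R x \<noteq> 0 \<Longrightarrow> steps p (R, M) T s'" "R x = 0 \<Longrightarrow> steps q (R, M) T s'"
  shows "steps (IfNZ x p q) (R, M) (1 + R x + T) s'"
proof (cases "R x = 0")
  case True
  with assms obtain n where "n \<le> T" "exec q (R, M) n s'" unfolding steps_def by blast
  with True show ?thesis unfolding steps_def
    by (intro exI[of _ "1 + bits (R x) + n"] conjI exec.IfFalse add_mono bits_le) auto
next
  case False
  with assms obtain n where "n \<le> T" "exec p (R, M) n s'" unfolding steps_def by blast
  with False show ?thesis unfolding steps_def
    by (intro exI[of _ "1 + bits (R x) + n"] conjI exec.IfTrue add_mono bits_le) auto
qed

text \<open>The index \<open>i\<close> counts completed rounds, and the loop register equals
  \<open>n - i\<close>, which forces exactly \<open>n\<close> rounds. Each round is charged the body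
  plus \<open>n + 1\<close> for the test; the extra unit in the first factor pays for the final,
  failing test.\<close>

lemma steps_WhileNZ:
  assumes body: "\<And>i R M. i < n \<Longrightarrow> Inv i R M \<Longrightarrow>
      \<exists>R' M'. steps p (R, M) T (R', M') \<and> Inv (Suc i) R' M'"
    and counter: "\<And>i R M. i \<le> n \<Longrightarrow> Inv i R M \<Longrightarrow> R c = n - i"
    and init: "Inv 0 R M"
  shows "\<exists>R' M'. steps (WhileNZ c p) (R, M) ((n + 1) * (T + n + 1)) (R', M') \<and> Inv n R' M'"
proof -
  \<comment> \<open>Induction on the number of rounds still to go, so that the hypothesis applies to
    the state after one round.\<close>
  have "\<exists>R' M'. steps (WhileNZ c p) (R, M) ((j + 1) * (T + n + 1)) (R', M') \<and> Inv n R' M'"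
    if "j \<le> n" "Inv (n - j) R M" for j R M
    using that
  proof (induction j arbitrary: R M)
    case 0
    with counter[of n R M] have "R c = 0" by simp
    then have "exec (WhileNZ c p) (R, M) (1 + bits (R c)) (R, M)" by (rule exec.WhileFalse)
    with \<open>R c = 0\<close> have "steps (WhileNZ c p) (R, M) (T + n + 1) (R, M)"
      unfolding steps_def by (intro exI[of _ "1 + bits (R c)"]) (simp add: floorlog_def)
    with 0 show ?case by auto
  next
    case (Suc j)
    have "n - Suc j < n" and eq: "Suc (n - Suc j) = n - j" using Suc.prems by auto
    from body[OF this(1) Suc.prems(2)] obtain R1 M1 where
      1: "steps p (R, M) T (R1, M1)" "Inv (n - j) R1 M1" unfolding eq by blast
    from Suc.IH[OF _ 1(2)] Suc.prems obtain R' M' where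
      2: "steps (WhileNZ c p) (R1, M1) ((j + 1) * (T + n + 1)) (R', M')" "Inv n R' M'" by auto
    from counter[OF _ Suc.prems(2)] Suc.prems have Rc: "R c = Suc j" by simp
    from 1(1) obtain a where a: "a \<le> T" "exec p (R, M) a (R1, M1)" unfolding steps_def by blast
    from 2(1) obtain b where b: "b \<le> (j + 1) * (T + n + 1)" "exec (WhileNZ c p) (R1, M1) b (R', M')"
      unfolding steps_def by blast
    from Rc have "R c \<noteq> 0" by simp
    from exec.WhileTrue[OF this a(2) b(2)]
    have "exec (WhileNZ c p) (R, M) (1 + bits (R c) + a + b) (R', M')" .
    moreover have "1 + bits (R c) + a + b \<le> (Suc j + 1) * (T + n + 1)"
      using a(1) b(1) bits_le[of "R c"] Rc Suc.prems by simp
    ultimately show ?case using 2(2) unfolding steps_def by blast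
  qed
  from this[of n] init show ?thesis by simp
qed

section \<open>Expressions with capped iteration and their compilation at polynomial cost\<close>

lemma nat_le_power: "2 \<le> B \<Longrightarrow> n \<le> (B::nat) ^ n"
  by (metis less_exp nat_less_le order_trans power_mono le0)

text \<open>Constant factors vanish into the exponent because \<open>c \<le> B ^ c\<close>. All
  bounds can thus be pure powers of \<open>B\<close>, a form that survives composition.\<close>

lemma const_mult_le_power:
  assumes "2 \<le> (B::nat)" "x \<le> c * B ^ k"
  shows "x \<le> B ^ (c + k)"
proof -
  have "c * B ^ k \<le> B ^ c * B ^ k" using nat_le_power[OF assms(1)] by simp
  with assms(2) show ?thesis unfolding power_add by linarith
qed

text \<open>
  Register 0 holds the length of the input, and \<open>Mem\<close> reads 0 beyond the input. The cap \<open>c\<close> in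
  \<open>Iter x a c e\<close> bounds each increment, so that iterations cannot grow exponentially.
\<close>

datatype exp =
    Num nat
  | Reg nat
  | Plus exp exp
  | Minus exp exp
  | Mem exp
  | Ite exp exp exp
  | Iter nat exp exp exp

fun eval :: "(nat \<Rightarrow> nat) \<Rightarrow> (nat \<Rightarrow> nat) \<Rightarrow> exp \<Rightarrow> nat" where
  "eval M R (Num c) = c"
| "eval M R (Reg x) = R x"
| "eval M R (Plus a b) = eval M R a + eval M R b"
| "eval M R (Minus a b) = eval M R a - eval M R b"
| "eval M R (Mem a) = (if eval M R a < R 0 then M (eval M R a) else 0)"
| "eval M R (Ite a b c) = (if eval M R a \<noteq> 0 then eval M R b else eval M R c)"
| "eval M R (Iter x a c e) =
    ((\<lambda>v. v + min (eval M (R(x := v)) e) (eval M R c)) ^^ eval M R a) 0"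

text \<open>Registers from \<open>d\<close> on are scratch space for the compiled code. Iteration
  never binds register 0, the input length, and \<open>0 < d\<close> at the leaf \<open>Num\<close>
  ensures that register 0 is not scratch.\<close>

fun scoped :: "nat \<Rightarrow> exp \<Rightarrow> bool" where
  "scoped d (Num c) \<longleftrightarrow> 0 < d"
| "scoped d (Reg x) \<longleftrightarrow> x < d"
| "scoped d (Plus a b) \<longleftrightarrow> scoped d a \<and> scoped d b"
| "scoped d (Minus a b) \<longleftrightarrow> scoped d a \<and> scoped d b"
| "scoped d (Mem a) \<longleftrightarrow> scoped d a"
| "scoped d (Ite a b c) \<longleftrightarrow> scoped d a \<and> scoped d b \<and> scoped d c"
| "scoped d (Iter x a c e) \<longleftrightarrow> 0 < x \<and> x < d \<and> scoped d a \<and> scoped d c \<and> scoped d e"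

lemma scoped_mono: "scoped d e \<Longrightarrow> d \<le> d' \<Longrightarrow> scoped d' e"
  by (induction e) auto

lemma scoped_pos: "scoped d e \<Longrightarrow> 0 < d"
  by (induction e) auto

text \<open>\<open>Mem\<close> never looks at addresses from \<open>R 0\<close> on, so the memories
  need to agree on the input only. This permits output to be written behind the input between
  evaluations.\<close>

lemma eval_cong:
  assumes "scoped d e" "\<forall>r<d. R r = R' r" "\<forall>a<R 0. M a = M' a"
  shows "eval M R e = eval M' R' e"
  using assms
proof (induction e arbitrary: R R')
  case (Mem e)
  then have "eval M R e = eval M' R' e" "R 0 = R' 0" using scoped_pos[of d e] by auto
  with Mem.prems(3) show ?case by auto
next
  case (Iter x a c e)
  have "eval M (R(x := v)) e = eval M' (R'(x := v)) e" for v
    by (rule Iter.IH(3)) (use Iter.prems in auto)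
  moreover have "eval M R a = eval M' R' a"
    by (rule Iter.IH(1)) (use Iter.prems in auto)
  moreover have "eval M R c = eval M' R' c"
    by (rule Iter.IH(2)) (use Iter.prems in auto)
  ultimately show ?case by simp
next
  case (Ite a b c)
  have "eval M R a = eval M' R' a"
    by (rule Ite.IH(1)) (use Ite.prems in auto)
  moreover have "eval M R b = eval M' R' b"
    by (rule Ite.IH(2)) (use Ite.prems in auto)
  moreover have "eval M R c = eval M' R' c"
    by (rule Ite.IH(3)) (use Ite.prems in auto)
  ultimately show ?case by simp
next
  case (Plus a b)
  have "eval M R a = eval M' R' a"
    by (rule Plus.IH(1)) (use Plus.prems in auto)
  moreover have "eval M R b = eval M' R' b"
    by (rule Plus.IH(2)) (use Plus.prems in auto)
  ultimately show ?case by simp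
next
  case (Minus a b)
  have "eval M R a = eval M' R' a"
    by (rule Minus.IH(1)) (use Minus.prems in auto)
  moreover have "eval M R b = eval M' R' b"
    by (rule Minus.IH(2)) (use Minus.prems in auto)
  ultimately show ?case by simp
qed auto

text \<open>Registers from \<open>d\<close> upwards act as a stack, and the result is left in
  \<open>d\<close>. Copying is setting to 0 and adding; the minimum of \<open>w\<close> and
  \<open>c\<close> is the truncated \<open>w - (w - c)\<close>. In the case \<open>Iter\<close>,
  \<open>d\<close> counts down, \<open>d + 1\<close> holds the cap and \<open>d + 2\<close> the old
  value of \<open>x\<close>, which is restored at the end.\<close>

fun compile :: "exp \<Rightarrow> nat \<Rightarrow> com" where
  "compile (Num c) d = Const d c"
| "compile (Reg x) d = Seq (Const d 0) (Add d d x)"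
| "compile (Plus a b) d = Seq (compile a d) (Seq (compile b (d + 1)) (Add d d (d + 1)))"
| "compile (Minus a b) d = Seq (compile a d) (Seq (compile b (d + 1)) (Sub d d (d + 1)))"
| "compile (Mem a) d = Seq (compile a d) (Seq (Sub (d + 1) 0 d)
    (IfNZ (d + 1) (Load d d) (Const d 0)))"
| "compile (Ite a b c) d = Seq (compile a d) (IfNZ d (compile b d) (compile c d))"
| "compile (Iter x a c e) d = Seq (compile a d) (Seq (compile c (d + 1))
    (Seq (Const (d + 2) 0) (Seq (Add (d + 2) (d + 2) x) (Seq (Const x 0)
    (Seq (WhileNZ d (Seq (compile e (d + 3)) (Seq (Sub (d + 4) (d + 3) (d + 1))
      (Seq (Sub (d + 3) (d + 3) (d + 4)) (Seq (Add x x (d + 3)) (Seq (Const (d + 4) 1)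
      (Sub d d (d + 4))))))))
    (Seq (Add d d x) (Seq (Const x 0) (Add x x (d + 2)))))))))"

text \<open>Polynomial cost in a form that composes: \<open>k\<close> is fixed, while
  \<open>B\<close> is any bound on the visible registers and the input cells. The value is bounded
  along with the time because it becomes an input of the surrounding code.\<close>

definition compiles :: "exp \<Rightarrow> nat \<Rightarrow> nat \<Rightarrow> bool" where
  "compiles e d k \<longleftrightarrow> (\<forall>B\<ge>2. \<forall>R M. (\<forall>r<d. R r \<le> B) \<longrightarrow> (\<forall>a<R 0. M a \<le> B) \<longrightarrow>
    eval M R e \<le> B ^ k \<and>
    (\<exists>R'. steps (compile e d) (R, M) (B ^ k) (R', M) \<and>
      (\<forall>r<d. R' r = R r) \<and> R' d = eval M R e))"

lemma compilesI:
  assumes "\<And>B R M. 2 \<le> B \<Longrightarrow> \<forall>r<d. R r \<le> B \<Longrightarrow> \<forall>a<R 0. M a \<le> B \<Longrightarrow>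
    \<exists>R' T. steps (compile e d) (R, M) T (R', M) \<and> T \<le> c * B ^ k \<and>
      (\<forall>r<d. R' r = R r) \<and> R' d = eval M R e \<and> eval M R e \<le> c * B ^ k"
  shows "compiles e d (c + k)"
  unfolding compiles_def
proof (intro allI impI)
  fix B R M assume B: "2 \<le> (B::nat)" "\<forall>r<d. R r \<le> B" "\<forall>a<R 0. (M a::nat) \<le> B"
  from assms[OF this] obtain R' T where *: "steps (compile e d) (R, M) T (R', M)" "T \<le> c * B ^ k"
     "(\<forall>r<d. R' r = R r)" "R' d = eval M R e" "eval M R e \<le> c * B ^ k" by blast
  with const_mult_le_power[OF B(1)] steps_mono
  show "eval M R e \<le> B ^ (c + k) \<and>
    (\<exists>R'. steps (compile e d) (R, M) (B ^ (c + k)) (R', M) \<and>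
      (\<forall>r<d. R' r = R r) \<and> R' d = eval M R e)" by blast
qed

lemma compilesD:
  assumes "compiles e d k" "2 \<le> B" "\<forall>r<d. R r \<le> B" "\<forall>a<R 0. M a \<le> B"
  obtains R' where "eval M R e \<le> B ^ k" "steps (compile e d) (R, M) (B ^ k) (R', M)"
    "\<forall>r<d. R' r = R r" "R' d = eval M R e"
  using assms unfolding compiles_def by blast

lemma compiles_mono:
  assumes "compiles e d k" "k \<le> k'"
  shows "compiles e d k'"
  unfolding compiles_def
proof (intro allI impI)
  fix B R M assume B: "2 \<le> (B::nat)" "\<forall>r<d. R r \<le> B" "\<forall>a<R 0. (M a::nat) \<le> B"
  have "B ^ k \<le> B ^ k'" using B assms by (simp add: power_increasing)
  obtain R' where "eval M R e \<le> B ^ k" "steps (compile e d) (R, M) (B ^ k) (R', M)"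
    "\<forall>r<d. R' r = R r" "R' d = eval M R e" using compilesD[OF assms(1) B] .
  with \<open>B ^ k \<le> B ^ k'\<close> show "eval M R e \<le> B ^ k' \<and>
    (\<exists>R'. steps (compile e d) (R, M) (B ^ k') (R', M) \<and>
      (\<forall>r<d. R' r = R r) \<and> R' d = eval M R e)"
    by (intro conjI exI[of _ R']) (simp_all add: steps_mono)
qed

text \<open>The common beginning of \<open>Plus\<close>, \<open>Minus\<close> and
  \<open>Iter\<close>: the second operand is evaluated one register higher, on top of the first
  result.\<close>

definition compiles_pair :: "exp \<Rightarrow> exp \<Rightarrow> nat \<Rightarrow> nat \<Rightarrow> bool" where
  "compiles_pair a b d k \<longleftrightarrow> (\<forall>B\<ge>2. \<forall>R M. (\<forall>r<d. R r \<le> B) \<longrightarrow> (\<forall>a<R 0. M a \<le> B) \<longrightarrow>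
    (\<exists>R1 R2. steps (compile a d) (R, M) (B ^ k) (R1, M) \<and>
       steps (compile b (d + 1)) (R1, M) (B ^ k) (R2, M) \<and>
       (\<forall>r<d. R2 r = R r) \<and> R2 d = eval M R a \<and> R2 (d + 1) = eval M R b \<and>
       eval M R a \<le> B ^ k \<and> eval M R b \<le> B ^ k))"

lemma compiles_pairD:
  assumes "compiles_pair a b d k" "2 \<le> B" "\<forall>r<d. R r \<le> B" "\<forall>a<R 0. M a \<le> B"
  obtains R1 R2 where "steps (compile a d) (R, M) (B ^ k) (R1, M)"
    "steps (compile b (d + 1)) (R1, M) (B ^ k) (R2, M)"
    "\<forall>r<d. R2 r = R r" "R2 d = eval M R a" "R2 (d + 1) = eval M R b"
    "eval M R a \<le> B ^ k" "eval M R b \<le> B ^ k"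
  using assms unfolding compiles_pair_def by blast

text \<open>While \<open>b\<close> runs, register \<open>d\<close> already holds a value up to
  \<open>B ^ k1\<close>, so the bound for \<open>b\<close> is applied with base
  \<open>B ^ Suc k1\<close>; exponents therefore multiply. The value of \<open>b\<close> is
  unaffected, as \<open>b\<close> does not mention register \<open>d\<close>.\<close>

lemma ex_compiles_pair:
  assumes "scoped d a" "scoped d b" "\<exists>k. compiles a d k" "\<exists>k. compiles b (d + 1) k"
  shows "\<exists>k>0. compiles_pair a b d k"
proof -
  from assms obtain k1 k2 where k: "compiles a d k1" "compiles b (d + 1) k2" by blast
  let ?k = "Suc k1 * Suc k2"
  have "\<exists>R1 R2. steps (compile a d) (R, M) (B ^ ?k) (R1, M) \<and>
       steps (compile b (d + 1)) (R1, M) (B ^ ?k) (R2, M) \<and>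
       (\<forall>r<d. R2 r = R r) \<and> R2 d = eval M R a \<and> R2 (d + 1) = eval M R b \<and>
       eval M R a \<le> B ^ ?k \<and> eval M R b \<le> B ^ ?k"
    if B: "2 \<le> B" "\<forall>r<d. R r \<le> B" "\<forall>a<R 0. M a \<le> B" for B R M
  proof -
    from compilesD[OF k(1) B] obtain R1 where
      1: "eval M R a \<le> B ^ k1" "steps (compile a d) (R, M) (B ^ k1) (R1, M)"
         "\<forall>r<d. R1 r = R r" "R1 d = eval M R a" .
    let ?B = "B ^ Suc k1"
    have mono: "B ^ i \<le> B ^ j" if "i \<le> j" for i j using B(1) that by (simp add: power_increasing)
    have le: "B \<le> ?B" "B ^ k1 \<le> ?B" using B(1) by simp_all
    have "\<forall>r<d + 1. R1 r \<le> ?B"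
      using 1(1,3,4) B(2) le order_trans by (metis Suc_eq_plus1 less_Suc_eq)
    moreover have "\<forall>a<R1 0. M a \<le> ?B"
      using 1(3) scoped_pos[OF assms(1)] B(3) le order_trans by metis
    moreover have "2 \<le> ?B" using B(1) le by linarith
    ultimately obtain R2 where 2: "eval M R1 b \<le> ?B ^ k2"
       "steps (compile b (d + 1)) (R1, M) (?B ^ k2) (R2, M)"
        "\<forall>r<d + 1. R2 r = R1 r" "R2 (d + 1) = eval M R1 b"
      using compilesD[OF k(2)] by metis
    have eq: "eval M R1 b = eval M R b"
      using 1(3) by (intro eval_cong[OF assms(2)]) auto
    have le1: "B ^ k1 \<le> B ^ ?k" by (rule mono) simp
    have le2: "?B ^ k2 \<le> B ^ ?k" unfolding power_mult[symmetric] by (rule mono) simp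
    show ?thesis
      using steps_mono[OF 1(2) le1] steps_mono[OF 2(2) le2] order_trans[OF 1(1) le1]
        order_trans[OF 2(1) le2] 1(3,4) 2(3,4) eq
      by (intro exI[of _ R1] exI[of _ R2]) (simp del: mult_Suc mult_Suc_right)
  qed
  then have "compiles_pair a b d ?k" unfolding compiles_pair_def by blast
  then show ?thesis by (intro exI[of _ ?k]) simp
qed

lemma ex_compiles: "scoped d e \<Longrightarrow> \<exists>k. compiles e d k"
proof (induction e arbitrary: d)
  case (Num c)
  have "compiles (Num c) d ((1 + c) + 0)"
  proof (rule compilesI)
    fix B :: nat and R M :: "nat \<Rightarrow> nat"
    show "\<exists>R' T. steps (compile (Num c) d) (R, M) T (R', M) \<and> T \<le> (1 + c) * B ^ 0 \<and>
      (\<forall>r<d. R' r = R r) \<and> R' d = eval M R (Num c) \<and> eval M R (Num c) \<le> (1 + c) * B ^ 0"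
      using steps_Const by fastforce
  qed
  then show ?case ..
next
  case (Reg x)
  have "compiles (Reg x) d (3 + 1)"
  proof (rule compilesI)
    fix B :: nat and R M :: "nat \<Rightarrow> nat" assume B: "2 \<le> B" "\<forall>r<d. R r \<le> B"
    have "steps (compile (Reg x) d) (R, M) ((1 + 0) + (1 + 0 + R x)) (R(d := R x), M)"
      using steps_Seq[OF steps_Const steps_Add[of d d x "R(d := 0)"]] Reg by simp
    then show "\<exists>R' T. steps (compile (Reg x) d) (R, M) T (R', M) \<and> T \<le> 3 * B ^ 1 \<and>
      (\<forall>r<d. R' r = R r) \<and> R' d = eval M R (Reg x) \<and> eval M R (Reg x) \<le> 3 * B ^ 1"
      using B Reg by (intro exI conjI) (assumption, auto)
  qed
  then show ?case ..
next
  case (Plus a b)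
  then have "scoped d a" "scoped d b" by auto
  from ex_compiles_pair[OF this Plus.IH(1)[OF this(1)] Plus.IH(2)[OF scoped_mono[OF this(2) le_add1]]]
  obtain k where k: "0 < k" "compiles_pair a b d k" by blast
  have "compiles (Plus a b) d (5 + k)"
  proof (rule compilesI)
    fix B :: nat and R M :: "nat \<Rightarrow> nat"
    assume B: "2 \<le> B" "\<forall>r<d. R r \<le> B" "\<forall>a<R 0. M a \<le> B"
    from compiles_pairD[OF k(2) this] obtain R1 R2 where *: "steps (compile a d) (R, M) (B ^ k) (R1, M)"
       "steps (compile b (d + 1)) (R1, M) (B ^ k) (R2, M)"
       "\<forall>r<d. R2 r = R r" "R2 d = eval M R a" "R2 (d + 1) = eval M R b"
       "eval M R a \<le> B ^ k" "eval M R b \<le> B ^ k" .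
    have one: "1 \<le> B ^ k" using B(1) by simp
    show "\<exists>R' T. steps (compile (Plus a b) d) (R, M) T (R', M) \<and> T \<le> 5 * B ^ k \<and>
      (\<forall>r<d. R' r = R r) \<and> R' d = eval M R (Plus a b) \<and> eval M R (Plus a b) \<le> 5 * B ^ k"
      unfolding compile.simps
      by (intro exI conjI, rule steps_Seq[OF *(1) steps_Seq[OF *(2) steps_Add]]) (use * one in auto)
  qed
  then show ?case ..
next
  case (Minus a b)
  then have "scoped d a" "scoped d b" by auto
  from ex_compiles_pair[OF this Minus.IH(1)[OF this(1)] Minus.IH(2)[OF scoped_mono[OF this(2) le_add1]]]
  obtain k where k: "0 < k" "compiles_pair a b d k" by blast
  have "compiles (Minus a b) d (5 + k)"
  proof (rule compilesI)
    fix B :: nat and R M :: "nat \<Rightarrow> nat"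
    assume B: "2 \<le> B" "\<forall>r<d. R r \<le> B" "\<forall>a<R 0. M a \<le> B"
    from compiles_pairD[OF k(2) this] obtain R1 R2 where *: "steps (compile a d) (R, M) (B ^ k) (R1, M)"
       "steps (compile b (d + 1)) (R1, M) (B ^ k) (R2, M)"
       "\<forall>r<d. R2 r = R r" "R2 d = eval M R a" "R2 (d + 1) = eval M R b"
       "eval M R a \<le> B ^ k" "eval M R b \<le> B ^ k" .
    have one: "1 \<le> B ^ k" using B(1) by simp
    show "\<exists>R' T. steps (compile (Minus a b) d) (R, M) T (R', M) \<and> T \<le> 5 * B ^ k \<and>
      (\<forall>r<d. R' r = R r) \<and> R' d = eval M R (Minus a b) \<and> eval M R (Minus a b) \<le> 5 * B ^ k"
      unfolding compile.simps
      by (intro exI conjI, rule steps_Seq[OF *(1) steps_Seq[OF *(2) steps_Sub]]) (use * one in auto)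
  qed
  then show ?case ..
next
  case (Mem a)
  then obtain k where k: "compiles a d k" and scoped: "scoped d a" by auto
  have "compiles (Mem a) d (9 + (1 + k))"
  proof (rule compilesI)
    fix B :: nat and R M :: "nat \<Rightarrow> nat"
    assume B: "2 \<le> B" "\<forall>r<d. R r \<le> B" "\<forall>a<R 0. M a \<le> B"
    from compilesD[OF k this] obtain R1 where
      1: "eval M R a \<le> B ^ k" "steps (compile a d) (R, M) (B ^ k) (R1, M)"
         "\<forall>r<d. R1 r = R r" "R1 d = eval M R a" .
    have R0: "R1 0 = R 0" "R 0 \<le> B" using 1(3) B(2) scoped_pos[OF scoped] by auto
    let ?R2 = "R1(d + 1 := R1 0 - R1 d)"
    let ?R3 = "?R2(d := eval M R (Mem a))"
    let ?v = "eval M R (Mem a)"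
    have v: "?v \<le> B" using B(3) by simp
    have "steps (IfNZ (d + 1) (Load d d) (Const d 0)) (?R2, M) (1 + ?R2 (d + 1) + (1 + ?R2 d + ?v)) (?R3, M)"
    proof (rule steps_IfNZ)
      assume "?R2 (d + 1) \<noteq> 0"
      then have "M (?R2 d) = ?v" using 1(4) R0 by simp
      then show "steps (Load d d) (?R2, M) (1 + ?R2 d + ?v) (?R3, M)"
        using steps_Load[of d d ?R2 M] by simp
    next
      assume "?R2 (d + 1) = 0"
      then have "?v = 0" using 1(4) R0 by simp
      then show "steps (Const d 0) (?R2, M) (1 + ?R2 d + ?v) (?R3, M)"
        using steps_Const[of d 0 ?R2 M] by (auto elim: steps_mono)
    qed
    note * = steps_Seq[OF 1(2) steps_Seq[OF steps_Sub this]]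
    obtain P where P: "P = B ^ (1 + k)" by blast
    have one: "1 \<le> P" "B ^ k \<le> P" "B \<le> P" using B(1) by (auto simp: P)
    show "\<exists>R' T. steps (compile (Mem a) d) (R, M) T (R', M) \<and> T \<le> 9 * B ^ (1 + k) \<and>
      (\<forall>r<d. R' r = R r) \<and> R' d = eval M R (Mem a) \<and> eval M R (Mem a) \<le> 9 * B ^ (1 + k)"
      unfolding compile.simps P[symmetric]
      apply (intro exI conjI, rule *)
      subgoal using one 1 R0 v B(1) by (simp del: eval.simps)
      using one 1(3) v by (auto simp del: eval.simps)
  qed
  then show ?case ..
next
  case (Ite a b c)
  then have scoped: "scoped d b" "scoped d c" "scoped d a" by auto
  from Ite.IH scoped obtain k1 k2 k3 where k: "compiles a d k1" "compiles b d k2" "compiles c d k3"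
    by blast
  let ?k = "k1 + k2 + k3"
  from k have k: "compiles a d ?k" "compiles b d ?k" "compiles c d ?k"
    by (auto elim: compiles_mono)
  have "compiles (Ite a b c) d (4 + ?k)"
  proof (rule compilesI)
    fix B :: nat and R M :: "nat \<Rightarrow> nat"
    assume B: "2 \<le> B" "\<forall>r<d. R r \<le> B" "\<forall>a<R 0. M a \<le> B"
    from compilesD[OF k(1) this] obtain R1 where
      1: "eval M R a \<le> B ^ ?k" "steps (compile a d) (R, M) (B ^ ?k) (R1, M)"
         "\<forall>r<d. R1 r = R r" "R1 d = eval M R a" .
    have B1: "\<forall>r<d. R1 r \<le> B" "\<forall>a<R1 0. M a \<le> B" using B 1(3) scoped_pos[OF scoped(1)] by auto
    have bc: "eval M R1 b = eval M R b" "eval M R1 c = eval M R c"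
      using 1(3) by (auto intro!: eval_cong[of d] simp: scoped)
    from compilesD[OF k(2) B(1) B1] obtain R2 where
      2: "eval M R b \<le> B ^ ?k" "steps (compile b d) (R1, M) (B ^ ?k) (R2, M)"
         "\<forall>r<d. R2 r = R1 r" "R2 d = eval M R b" using bc by metis
    from compilesD[OF k(3) B(1) B1] obtain R3 where
      3: "eval M R c \<le> B ^ ?k" "steps (compile c d) (R1, M) (B ^ ?k) (R3, M)"
         "\<forall>r<d. R3 r = R1 r" "R3 d = eval M R c" using bc by metis
    let ?R' = "if R1 d \<noteq> 0 then R2 else R3"
    have "steps (IfNZ d (compile b d) (compile c d)) (R1, M) (1 + R1 d + B ^ ?k) (?R', M)"
      by (rule steps_IfNZ) (use 2 3 in auto)
    note * = steps_Seq[OF 1(2) this]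
    have one: "1 \<le> B ^ ?k" using B(1) by simp
    show "\<exists>R' T. steps (compile (Ite a b c) d) (R, M) T (R', M) \<and> T \<le> 4 * B ^ ?k \<and>
      (\<forall>r<d. R' r = R r) \<and> R' d = eval M R (Ite a b c) \<and> eval M R (Ite a b c) \<le> 4 * B ^ ?k"
      unfolding compile.simps
      apply (intro exI conjI, rule *)
      using one 1 2(1) 3(1) apply simp
      using 1 2 3 apply simp
      using 2 3 1 apply simp
      using 2 3 one by simp
  qed
  then show ?case ..
next
  case (Iter x a c e)
  then have scoped: "0 < x" "x < d" "scoped d a" "scoped d c" "scoped d e" by auto
  have "\<exists>k. compiles a d k" "\<exists>k. compiles c (d + 1) k"
    by (rule Iter.IH(1)[OF scoped(3)])
      (rule Iter.IH(2)[OF scoped_mono[OF scoped(4) le_add1]])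
  from ex_compiles_pair[OF scoped(3,4) this] obtain k where k: "0 < k" "compiles_pair a c d k" by blast
  obtain ke where ke: "compiles e (d + 3) ke"
    using Iter.IH(3)[OF scoped_mono[OF scoped(5) le_add1]] by (rule exE)
  \<comment> \<open>Below, \<open>D\<close> bounds the number of rounds times the cap, hence all
    registers that the body sees; \<open>E = D ^ Suc (Suc ke)\<close> bounds one evaluation of
    \<open>e\<close>, and \<open>E * E = B ^ (2 * ?k)\<close> the whole loop up to a
    constant.\<close>
  let ?k = "2 * k * Suc (Suc ke)"
  have "compiles (Iter x a c e) d (100 + (2 * ?k))"
  proof (rule compilesI)
    fix B :: nat and R M :: "nat \<Rightarrow> nat"
    assume B: "2 \<le> B" "\<forall>r<d. R r \<le> B" "\<forall>a<R 0. M a \<le> B"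
    let ?a = "eval M R a" and ?c = "eval M R c"
    from compiles_pairD[OF k(2) B] obtain R1 R2 where 1: "steps (compile a d) (R, M) (B ^ k) (R1, M)"
       "steps (compile c (d + 1)) (R1, M) (B ^ k) (R2, M)"
       "\<forall>r<d. R2 r = R r" "R2 d = ?a" "R2 (d + 1) = ?c"
       "?a \<le> B ^ k" "?c \<le> B ^ k" .
    define g where "g v = v + min (eval M (R(x := v)) e) ?c" for v
    define D where "D = B ^ (2 * k)"
    have "B ^ 1 \<le> B ^ k" using B(1) k(1) by (intro power_increasing) auto
    then have Bk: "B \<le> B ^ k" by simp
    have kD: "B ^ k * B ^ k = D" unfolding D_def by (simp add: power_add mult_2)
    have kD': "B ^ k \<le> D" unfolding D_def using B(1) by (intro power_increasing) auto
    have D: "2 \<le> D" "B \<le> D" "?a \<le> D" "?c \<le> D" using kD' Bk B(1) 1 by linarith+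
    define E where "E = D ^ Suc (Suc ke)"
    have E: "D \<le> E" "D ^ ke \<le> E" "B ^ k \<le> E" "1 \<le> E"
    proof -
      show "D ^ ke \<le> E" unfolding E_def using D(1) by (intro power_increasing) auto
      have "D ^ 1 \<le> E" unfolding E_def using D(1) by (intro power_increasing) auto
      then show "D \<le> E" by simp
      with kD' show "B ^ k \<le> E" by simp
      show "1 \<le> E" using \<open>D \<le> E\<close> D(1) by simp
    qed
    \<comment> \<open>The cap limits every increment to \<open>?c\<close>, so growth is linear in
      the number of rounds.\<close>
    have it: "(g ^^ i) 0 \<le> i * ?c" for i
      by (induction i) (auto simp: g_def)
    have itD: "(g ^^ i) 0 \<le> D" if "i \<le> ?a" for i
    proof -
      have "i * ?c \<le> B ^ k * B ^ k" using that 1 by (intro mult_mono) auto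
      with it[of i] kD show ?thesis by linarith
    qed
    define Inv where "Inv i Q N \<longleftrightarrow> N = M \<and> Q x = (g ^^ i) 0 \<and> Q d = ?a - i \<and> Q (d + 1) = ?c \<and>
      Q (d + 2) = R x \<and> (\<forall>r<d. r \<noteq> x \<longrightarrow> Q r = R r)" for i Q N
    let ?body = "Seq (compile e (d + 3)) (Seq (Sub (d + 4) (d + 3) (d + 1))
      (Seq (Sub (d + 3) (d + 3) (d + 4)) (Seq (Add x x (d + 3)) (Seq (Const (d + 4) 1)
      (Sub d d (d + 4))))))"
    have loop: "\<exists>R' M'. steps (WhileNZ d ?body) (Q, M) ((?a + 1) * (20 * E + ?a + 1)) (R', M') \<and> Inv ?a R' M'"
      if init: "Inv 0 Q M" for Q
    proof (rule steps_WhileNZ[where Inv = Inv])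
      fix i Q N assume i: "i < ?a" and inv: "Inv i Q N"
      from inv have N: "N = M" and Qx: "Q x = (g ^^ i) 0" and Qd: "Q d = ?a - i" "Q (d + 1) = ?c"
        "Q (d + 2) = R x" and Qr: "\<forall>r<d. r \<noteq> x \<longrightarrow> Q r = R r" unfolding Inv_def by auto
      have "Q r \<le> D" if "r < d + 3" for r
      proof -
        consider "r = x" | "r = d" | "r = d + 1" | "r = d + 2" | "r < d" "r \<noteq> x" using \<open>r < d + 3\<close> by linarith
        then show ?thesis
        proof cases
          case 1 then show ?thesis using Qx itD[of i] i by simp
        next
          case 4 then show ?thesis using Qd B(2) scoped D(2) order_trans by metis
        next
          case 5 then show ?thesis using Qr B(2) D(2) order_trans by metis
        qed (use Qd D in auto)
      qed
      moreover have Q0: "Q 0 = R 0" using Qr scoped by simp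
      moreover have "\<forall>a<Q 0. M a \<le> D" using B(3) D(2) Q0 order_trans by metis
      ultimately obtain Q1 where 2: "eval M Q e \<le> D ^ ke"
        "steps (compile e (d + 3)) (Q, M) (D ^ ke) (Q1, M)"
        "\<forall>r<d + 3. Q1 r = Q r" "Q1 (d + 3) = eval M Q e"
        using compilesD[OF ke D(1), of Q M] by metis
      have Qe: "eval M Q e = eval M (R(x := (g ^^ i) 0)) e"
        using Qr Qx by (intro eval_cong[OF scoped(5)]) auto
      define w where "w = eval M Q e"
      have w: "w \<le> E" "Q1 (d + 3) = w" "(g ^^ i) 0 + min w ?c = (g ^^ Suc i) 0"
        using 2 E Qe unfolding w_def by (auto simp: g_def)
      have Q1: "Q1 x = (g ^^ i) 0" "Q1 d = ?a - i" "Q1 (d + 1) = ?c" "Q1 (d + 2) = R x"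
         "\<forall>r<d. r \<noteq> x \<longrightarrow> Q1 r = R r"
        using 2(3) Qx Qd Qr scoped by auto
      have le: "(g ^^ i) 0 \<le> E" "?a \<le> E" "?c \<le> E" using itD[of i] i D E by auto
      let ?Q2 = "Q1(d + 4 := w - ?c)"
      let ?Q3 = "?Q2(d + 3 := w - (w - ?c))"
      let ?Q4 = "?Q3(x := (g ^^ i) 0 + (w - (w - ?c)))"
      let ?Q5 = "?Q4(d + 4 := 1)"
      let ?Q6 = "?Q5(d := ?a - i - 1)"
      have s: "steps (Sub (d + 4) (d + 3) (d + 1)) (Q1, M) (1 + w + ?c) (?Q2, M)"
         "steps (Sub (d + 3) (d + 3) (d + 4)) (?Q2, M) (1 + w + (w - ?c)) (?Q3, M)"
         "steps (Add x x (d + 3)) (?Q3, M) (1 + (g ^^ i) 0 + (w - (w - ?c))) (?Q4, M)"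
         "steps (Const (d + 4) 1) (?Q4, M) (1 + 1) (?Q5, M)"
         "steps (Sub d d (d + 4)) (?Q5, M) (1 + (?a - i) + 1) (?Q6, M)"
        using steps_Sub[of "d + 4" "d + 3" "d + 1" Q1 M] steps_Sub[of "d + 3" "d + 3" "d + 4" ?Q2 M]
          steps_Add[of x x "d + 3" ?Q3 M] steps_Const[of "d + 4" 1 ?Q4 M] steps_Sub[of d d "d + 4" ?Q5 M]
          w(2) Q1 scoped(2) by simp_all
      note S = steps_Seq[OF 2(2) steps_Seq[OF s(1) steps_Seq[OF s(2) steps_Seq[OF s(3) steps_Seq[OF s(4,5)]]]]]
      have "steps ?body (Q, M) (20 * E) (?Q6, M)"
        by (rule steps_mono[OF S]) (use E w(1) le in linarith)
      moreover have "Inv (Suc i) ?Q6 M" unfolding Inv_def using Q1 scoped(2) w(3) by auto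
      ultimately show "\<exists>R' M'. steps ?body (Q, N) (20 * E) (R', M') \<and> Inv (Suc i) R' M'"
        using N by blast
    next
      fix i Q N show "Inv i Q N \<Longrightarrow> Q d = ?a - i" by (simp add: Inv_def)
    qed (rule that)
    let ?R3 = "R2(d + 2 := 0)"
    let ?R4 = "?R3(d + 2 := R x)"
    let ?R5 = "?R4(x := 0)"
    have "Inv 0 ?R5 M" unfolding Inv_def using 1 scoped by auto
    from loop[OF this] obtain Q where
      L: "steps (WhileNZ d ?body) (?R5, M) ((?a + 1) * (20 * E + ?a + 1)) (Q, M)" and I: "Inv ?a Q M"
      by (auto simp: Inv_def)
    from I have Q: "Q x = (g ^^ ?a) 0" "Q d = 0" "Q (d + 2) = R x" "\<forall>r<d. r \<noteq> x \<longrightarrow> Q r = R r"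
      unfolding Inv_def by auto
    let ?Q1 = "Q(d := (g ^^ ?a) 0)"
    let ?Q2 = "?Q1(x := 0)"
    let ?Q3 = "?Q2(x := R x)"
    have s: "steps (Const (d + 2) 0) (R2, M) (1 + 0) (?R3, M)"
      "steps (Add (d + 2) (d + 2) x) (?R3, M) (1 + 0 + R x) (?R4, M)"
      "steps (Const x 0) (?R4, M) (1 + 0) (?R5, M)"
      "steps (Add d d x) (Q, M) (1 + 0 + (g ^^ ?a) 0) (?Q1, M)"
      "steps (Const x 0) (?Q1, M) (1 + 0) (?Q2, M)"
      "steps (Add x x (d + 2)) (?Q2, M) (1 + 0 + R x) (?Q3, M)"
      using steps_Const[of "d + 2" 0 R2 M] steps_Add[of "d + 2" "d + 2" x ?R3 M] steps_Const[of x 0 ?R4 M]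
        steps_Add[of d d x Q M] steps_Const[of x 0 ?Q1 M] steps_Add[of x x "d + 2" ?Q2 M] 1 Q scoped(2)
      by simp_all
    note S = steps_Seq[OF 1(1) steps_Seq[OF 1(2) steps_Seq[OF s(1) steps_Seq[OF s(2) steps_Seq[OF s(3)
      steps_Seq[OF L steps_Seq[OF s(4) steps_Seq[OF s(5,6)]]]]]]]]
    have E2: "E * E = B ^ (2 * ?k)"
      unfolding E_def D_def by (simp add: power_mult[symmetric] power_add[symmetric] algebra_simps)
    have "?a + 1 \<le> 2 * E" "20 * E + ?a + 1 \<le> 22 * E" using E D by linarith+
    then have "(?a + 1) * (20 * E + ?a + 1) \<le> 2 * E * (22 * E)" by (rule mult_mono) auto
    also have "\<dots> = 44 * B ^ (2 * ?k)" using E2 by simp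
    finally have c: "(?a + 1) * (20 * E + ?a + 1) \<le> 44 * B ^ (2 * ?k)" .
    have EE: "E \<le> B ^ (2 * ?k)" unfolding E2[symmetric] using E(4) by simp
    have "R x \<le> E" using B(2) scoped(2) D E by (metis order_trans)
    have ev: "eval M R (Iter x a c e) = (g ^^ ?a) 0" by (simp add: g_def[abs_def])
    have gE: "(g ^^ ?a) 0 \<le> E" using itD[of ?a] E by simp
    show "\<exists>R' T. steps (compile (Iter x a c e) d) (R, M) T (R', M) \<and> T \<le> 100 * B ^ (2 * ?k) \<and>
      (\<forall>r<d. R' r = R r) \<and> R' d = eval M R (Iter x a c e) \<and> eval M R (Iter x a c e) \<le> 100 * B ^ (2 * ?k)"
      unfolding compile.simps ev
    proof (intro exI conjI, rule S)
      show "\<forall>r<d. ?Q3 r = R r" using Q scoped(2) by auto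
      show "?Q3 d = (g ^^ ?a) 0" using scoped(2) by simp
      show "(g ^^ ?a) 0 \<le> 100 * B ^ (2 * ?k)" using gE EE by linarith
    qed (use c gE EE \<open>R x \<le> E\<close> E in linarith)
  qed
  then show ?case ..
qed

section \<open>Polynomial-time transducers\<close>

text \<open>Registers beyond \<open>top_reg p\<close> are still 0 after a run from an initial state,
  so clearing finitely many registers restores the initial form. \<open>Store\<close> changes the
  memory only.\<close>

fun top_reg :: "com \<Rightarrow> nat" where
  "top_reg (Const x c) = x"
| "top_reg (Add x y z) = x"
| "top_reg (Sub x y z) = x"
| "top_reg (Load x y) = x"
| "top_reg (Store x y) = 0"
| "top_reg (Seq p q) = max (top_reg p) (top_reg q)"
| "top_reg (IfNZ x p q) = max (top_reg p) (top_reg q)"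
| "top_reg (WhileNZ x p) = top_reg p"

lemma exec_unwritten: "exec p s n s' \<Longrightarrow> top_reg p < r \<Longrightarrow> fst s' r = fst s r"
  by (induction rule: exec.induct) auto

lemma steps_unwritten: "steps p (R, M) n (R', M') \<Longrightarrow> top_reg p < r \<Longrightarrow> R' r = R r"
  unfolding steps_def using exec_unwritten by fastforce

text \<open>Register 0 is left alone, as it carries the output length; the base case is a harmless
  write to register 1.\<close>

fun clear :: "nat \<Rightarrow> com" where
  "clear 0 = Const 1 0"
| "clear (Suc n) = Seq (clear n) (Const (Suc n) 0)"

lemma steps_clear:
  assumes "0 < n"
  shows "steps (clear n) (R, M) (n + 1) (\<lambda>r. if r \<in> {1..n} then 0 else R r, M)"
  using assms
proof (induction n rule: nat_induct_non_zero)
  case 1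
  have "steps (clear 1) (R, M) (1 + 0 + (1 + 0)) (R(1 := 0, 1 := 0), M)"
    using steps_Seq[OF steps_Const[of 1 0 R M] steps_Const[of 1 0]] by simp
  moreover have "R(1 := 0, 1 := 0) = (\<lambda>r. if r \<in> {1..1} then 0 else R r)" by auto
  ultimately show ?case by simp
next
  case (Suc n)
  have "(\<lambda>r. if r \<in> {1..n} then 0 else R r)(Suc n := 0) = (\<lambda>r. if r \<in> {1..Suc n} then 0 else R r)"
    by auto
  with steps_Seq[OF Suc.IH steps_Const[of "Suc n" 0]] show ?case by simp
qed

section \<open>Sweeping through the memory with two pointers\<close>

definition advance :: "nat \<Rightarrow> com" where
  "advance d = Seq (Const (d + 3) 1) (Seq (Add (d + 1) (d + 1) (d + 3))
    (Seq (Add 1 1 (d + 3)) (Sub (d + 2) (d + 2) (d + 3))))"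

text \<open>Writing the output, moving it and clearing the rest all have this shape: registers 1 and
  \<open>d + 1\<close> are pointers moving upwards, and \<open>d + 2\<close> counts the rounds left.
  The summand \<open>8 + x + y + 3 * n\<close> pays for \<open>advance\<close>. The invariant
  \<open>J\<close> speaks of the memory only, since \<open>p\<close> keeps all registers below
  \<open>d + 3\<close>.\<close>

lemma steps_pointer_loop:
  assumes d: "2 \<le> d"
    and op: "\<And>i R M. i < n \<Longrightarrow> J i M \<Longrightarrow> R 1 = x + i \<Longrightarrow> R (d + 1) = y + i \<Longrightarrow>
      R (d + 2) = n - i \<Longrightarrow> \<forall>r\<le>d. r \<noteq> 1 \<longrightarrow> R r = R0 r \<Longrightarrow>
      \<exists>R' M'. steps p (R, M) T (R', M') \<and> J (Suc i) M' \<and> (\<forall>r<d + 3. R' r = R r)"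
    and init: "J 0 M" "R0 1 = x" "R0 (d + 1) = y" "R0 (d + 2) = n"
  shows "\<exists>R' M'. steps (WhileNZ (d + 2) (Seq p (advance d))) (R0, M)
      ((n + 1) * (T + (8 + x + y + 3 * n) + n + 1)) (R', M') \<and>
    J n M' \<and> R' 1 = x + n \<and> R' (d + 1) = y + n \<and> (\<forall>r\<le>d. r \<noteq> 1 \<longrightarrow> R' r = R0 r)"
proof -
  define Inv where "Inv i R M \<longleftrightarrow> J i M \<and> R 1 = x + i \<and> R (d + 1) = y + i \<and>
      R (d + 2) = n - i \<and> (\<forall>r\<le>d. r \<noteq> 1 \<longrightarrow> R r = R0 r)" for i R M
  have "\<exists>R' M'. steps (WhileNZ (d + 2) (Seq p (advance d))) (R0, M)
      ((n + 1) * (T + (8 + x + y + 3 * n) + n + 1)) (R', M') \<and> Inv n R' M'"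
  proof (rule steps_WhileNZ[where Inv = Inv])
    fix i R M assume i: "i < n" and inv: "Inv i R M"
    from inv op[OF i, of M R] obtain R1 M1 where 1: "steps p (R, M) T (R1, M1)" "J (Suc i) M1"
      "\<forall>r<d + 3. R1 r = R r" unfolding Inv_def by blast
    have R1: "R1 1 = x + i" "R1 (d + 1) = y + i" "R1 (d + 2) = n - i" "\<forall>r\<le>d. r \<noteq> 1 \<longrightarrow> R1 r = R0 r"
      using inv 1(3) unfolding Inv_def by auto
    let ?R2 = "R1(d + 3 := 1)"
    let ?R3 = "?R2(d + 1 := y + i + 1)"
    let ?R4 = "?R3(1 := x + i + 1)"
    let ?R5 = "?R4(d + 2 := n - i - 1)"
    have s: "steps (Const (d + 3) 1) (R1, M1) (1 + 1) (?R2, M1)"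
      "steps (Add (d + 1) (d + 1) (d + 3)) (?R2, M1) (1 + (y + i) + 1) (?R3, M1)"
      "steps (Add 1 1 (d + 3)) (?R3, M1) (1 + (x + i) + 1) (?R4, M1)"
      "steps (Sub (d + 2) (d + 2) (d + 3)) (?R4, M1) (1 + (n - i) + 1) (?R5, M1)"
      using steps_Const[of "d + 3" 1 R1 M1] steps_Add[of "d + 1" "d + 1" "d + 3" ?R2 M1]
        steps_Add[of 1 1 "d + 3" ?R3 M1] steps_Sub[of "d + 2" "d + 2" "d + 3" ?R4 M1] R1 d
      by simp_all
    have "steps (Seq p (advance d)) (R, M) (T + (8 + x + y + 3 * n)) (?R5, M1)"
      unfolding advance_def
      by (rule steps_mono[OF steps_Seq[OF 1(1) steps_Seq[OF s(1) steps_Seq[OF s(2) steps_Seq[OF s(3,4)]]]]])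
        (use i in auto)
    moreover have "Inv (Suc i) ?R5 M1" unfolding Inv_def using R1 1(2) d by auto
    ultimately show "\<exists>R' M'. steps (Seq p (advance d)) (R, M) (T + (8 + x + y + 3 * n)) (R', M') \<and>
      Inv (Suc i) R' M'" by blast
  next
    show "Inv 0 R0 M" using init unfolding Inv_def by simp
  qed (simp add: Inv_def)
  then show ?thesis unfolding Inv_def by blast
qed

text \<open>One pointer goes to the front of the memory, the other to the first cell behind the
  input, and the counter is set to the output length kept in register \<open>d\<close>.\<close>

definition rewind :: "nat \<Rightarrow> com" where
  "rewind d = Seq (Const (d + 1) 0) (Seq (Add (d + 1) (d + 1) 0)
    (Seq (Const (d + 2) 0) (Seq (Add (d + 2) (d + 2) d) (Const 1 0))))"

lemma steps_rewind:
  assumes "2 \<le> d"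
  shows "steps (rewind d) (R, M) (5 + R 0 + R d) (R(d + 1 := R 0, d + 2 := R d, 1 := 0), M)"
proof -
  let ?R1 = "R(d + 1 := 0)"
  let ?R2 = "?R1(d + 1 := R 0)"
  let ?R3 = "?R2(d + 2 := 0)"
  let ?R4 = "?R3(d + 2 := R d)"
  let ?R5 = "?R4(1 := 0)"
  have s: "steps (Const (d + 1) 0) (R, M) (1 + 0) (?R1, M)"
    "steps (Add (d + 1) (d + 1) 0) (?R1, M) (1 + 0 + R 0) (?R2, M)"
    "steps (Const (d + 2) 0) (?R2, M) (1 + 0) (?R3, M)"
    "steps (Add (d + 2) (d + 2) d) (?R3, M) (1 + 0 + R d) (?R4, M)"
    "steps (Const 1 0) (?R4, M) (1 + 0) (?R5, M)"
    using steps_Const[of "d + 1" 0 R M] steps_Add[of "d + 1" "d + 1" 0 ?R1 M]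
      steps_Const[of "d + 2" 0 ?R2 M] steps_Add[of "d + 2" "d + 2" d ?R3 M] steps_Const[of 1 0 ?R4 M]
      assms by simp_all
  have eq: "?R5 = R(d + 1 := R 0, d + 2 := R d, 1 := 0)" by auto
  show ?thesis unfolding rewind_def eq[symmetric]
    by (rule steps_mono[OF steps_Seq[OF s(1) steps_Seq[OF s(2) steps_Seq[OF s(3) steps_Seq[OF s(4,5)]]]]]) simp
qed

text \<open>
  The output is written behind the input, so that the expressions can still read the input; it is
  moved to the front afterwards, and the memory behind it is cleared.
\<close>

definition transducer_main :: "exp \<Rightarrow> exp \<Rightarrow> nat \<Rightarrow> com" where
  "transducer_main len e d = Seq (compile len d)
    (Seq (rewind d)
    (Seq (WhileNZ (d + 2) (Seq (Seq (compile e (d + 3)) (Store (d + 1) (d + 3))) (advance d)))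
    (Seq (rewind d)
    (Seq (WhileNZ (d + 2) (Seq (Seq (Load (d + 3) (d + 1)) (Store 1 (d + 3))) (advance d)))
    (Seq (Const (d + 2) 0) (Seq (Add (d + 2) (d + 2) 0)
    (Seq (WhileNZ (d + 2) (Seq (Seq (Const (d + 3) 0) (Store 1 (d + 3))) (advance d)))
    (Seq (Const 0 0) (Add 0 0 d)))))))))"

definition transducer :: "exp \<Rightarrow> exp \<Rightarrow> nat \<Rightarrow> com" where
  "transducer len e d =
    Seq (transducer_main len e d) (clear (Suc (top_reg (transducer_main len e d))))"

abbreviation memory :: "nat list \<Rightarrow> nat \<Rightarrow> nat" where
  "memory xs \<equiv> \<lambda>i. if i < length xs then xs ! i else 0"

definition transduce :: "exp \<Rightarrow> exp \<Rightarrow> nat list \<Rightarrow> nat list" where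
  "transduce len e xs =
    map (\<lambda>i. eval (memory xs) ((\<lambda>_. 0)(0 := length xs, 1 := i)) e)
      [0..<eval (memory xs) ((\<lambda>_. 0)(0 := length xs)) len]"

text \<open>The final state is again of the form \<open>initial\<close>, so another program can be
  run right after the transducer. The exponent \<open>K\<close> is uniform in the input.\<close>

lemma ex_transducer:
  assumes d: "2 \<le> d" and scoped: "scoped d len" "scoped d e"
  shows "\<exists>K. \<forall>B\<ge>2. \<forall>xs. length xs \<le> B \<longrightarrow> (\<forall>x\<in>set xs. x \<le> B) \<longrightarrow>
    steps (transducer len e d) (initial xs) (B ^ K) (initial (transduce len e xs))"
proof -
  from ex_compiles[OF scoped(1)] obtain kl where kl: "compiles len d kl" by blast
  from ex_compiles[OF scoped_mono[OF scoped(2) le_add1]] obtain ke where ke: "compiles e (d + 3) ke"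
    by blast
  let ?main = "transducer_main len e d"
  \<comment> \<open>\<open>?k\<close> is the exponent of the common bound \<open>E = B ^ ?k\<close>
    below. \<open>top_reg ?main\<close> enters the constant through the final clearing of registers;
    2000 is a generous allowance for everything else.\<close>
  let ?k = "Suc (Suc kl) * Suc (Suc ke)"
  let ?c = "2000 + top_reg ?main"
  have "steps (transducer len e d) (initial xs) (B ^ (?c + 2 * ?k)) (initial (transduce len e xs))"
    if B: "2 \<le> B" and xs: "length xs \<le> B" "\<forall>x\<in>set xs. x \<le> B" for B xs
  proof -
    define L where "L = length xs"
    define M where "M = memory xs"
    define R :: "nat \<Rightarrow> nat" where "R = (\<lambda>_. 0)(0 := L)"
    define n where "n = eval M R len"
    define f where "f i = eval M (R(1 := i)) e" for i
    have M_le: "M a \<le> B" for a using xs by (auto simp: M_def)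
    have init: "initial xs = (R, M)" by (simp add: initial_def R_def L_def M_def)
    have ys: "transduce len e xs = map f [0..<n]"
      unfolding transduce_def f_def n_def R_def M_def L_def ..
    have "\<forall>r<d. R r \<le> B" "\<forall>a<R 0. M a \<le> B" using xs by (auto simp: R_def L_def M_def)
    from compilesD[OF kl B this] obtain R1 where
      1: "n \<le> B ^ kl" "steps (compile len d) (R, M) (B ^ kl) (R1, M)"
        "\<forall>r<d. R1 r = R r" "R1 d = n" unfolding n_def .
    \<comment> \<open>While the output is written, the registers visible to \<open>e\<close> include
      the output pointer, which can reach \<open>B + B ^ kl\<close>; hence the larger base
      \<open>D\<close>.\<close>
    define D where "D = B ^ Suc (Suc kl)"
    have D: "B + B ^ kl \<le> D" "2 \<le> D"
    proof -
      have "1 \<le> B ^ kl" using B by simp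
      then have "B + B ^ kl \<le> B * B ^ kl + B * B ^ kl" using B
        by (intro add_mono) auto
      also have "\<dots> \<le> D" unfolding D_def power_Suc using mult_le_mono1[OF B, of "B * B ^ kl"] by linarith
      finally show "B + B ^ kl \<le> D" .
      with B show "2 \<le> D" by simp
    qed
    define E where "E = D ^ Suc (Suc ke)"
    have E: "D \<le> E" "D ^ ke \<le> E" "1 \<le> E"
    proof -
      show "D ^ ke \<le> E" unfolding E_def using D(2) by (intro power_increasing) auto
      have "D ^ 1 \<le> E" unfolding E_def using D(2) by (intro power_increasing) auto
      then show "D \<le> E" by simp
      with D(2) show "1 \<le> E" by simp
    qed
    have le: "L \<le> E" "n \<le> E" "L + n \<le> E" "B ^ kl \<le> E" using D(1) 1(1) xs(1) E(1) unfolding L_def by linarith+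
    let ?R2 = "R1(d + 1 := L, d + 2 := n, 1 := 0)"
    have s1: "steps (rewind d) (R1, M) (5 + L + n) (?R2, M)"
      using steps_rewind[OF d, of R1 M] 1(3,4) d by (simp add: R_def)
    have f_le: "f i \<le> E" if i: "i < n" for i
    proof -
      have "eval M (R(1 := i)) e \<le> D ^ ke"
      proof (rule compilesD[OF ke D(2)])
        show "\<forall>r<d + 3. (R(1 := i)) r \<le> D"
          using i 1(1) D(1) xs(1) by (auto simp: R_def L_def)
        show "\<forall>a<(R(1 := i)) 0. M a \<le> D"
          using M_le D(1) by (meson add_leD1 order_trans)
      qed
      with E show ?thesis unfolding f_def by linarith
    qed
    define J1 where "J1 i N \<longleftrightarrow> N = (\<lambda>a. if L \<le> a \<and> a < L + i then f (a - L) else M a)" for i N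
    have "\<exists>R' M'. steps (WhileNZ (d + 2) (Seq (Seq (compile e (d + 3)) (Store (d + 1) (d + 3))) (advance d)))
      (?R2, M) ((n + 1) * ((E + (1 + E + E)) + (8 + 0 + L + 3 * n) + n + 1)) (R', M') \<and>
      J1 n M' \<and> R' 1 = 0 + n \<and> R' (d + 1) = L + n \<and> (\<forall>r\<le>d. r \<noteq> 1 \<longrightarrow> R' r = ?R2 r)"
    proof (rule steps_pointer_loop[OF d])
      fix i Q N assume i: "i < n" and N: "J1 i N" and Q: "Q 1 = 0 + i" "Q (d + 1) = L + i"
        "Q (d + 2) = n - i" "\<forall>r\<le>d. r \<noteq> 1 \<longrightarrow> Q r = ?R2 r"
      have Qd: "Q d = n" using Q(4) 1(4) d by auto
      have Qr: "Q r = (R(1 := i)) r" if "r < d" for r using Q(1,4) 1(3) d that by auto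
      have Q0: "Q 0 = L" using Qr[of 0] d by (simp add: R_def)
      have NM: "\<forall>a<Q 0. M a = N a" using N Q0 unfolding J1_def by auto
      have bQ: "\<forall>r<d + 3. Q r \<le> D"
      proof (intro allI impI)
        fix r assume "r < d + 3"
        then consider "r < d" | "r = d" | "r = d + 1" | "r = d + 2" by linarith
        then show "Q r \<le> D"
          using Qr[of r] Qd Q(2,3) i D(1) 1(1) xs(1) by cases (auto simp: R_def L_def)
      qed
      have bN: "\<forall>a<Q 0. N a \<le> D"
        using NM M_le D(1) by (metis add_leD1 order_trans)
      have ev: "eval N Q e = f i"
        unfolding f_def using Qr NM by (intro eval_cong[OF scoped(2)]) auto
      from compilesD[OF ke D(2) bQ bN] obtain Q1 where
        2: "steps (compile e (d + 3)) (Q, N) (D ^ ke) (Q1, N)" "\<forall>r<d + 3. Q1 r = Q r"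
          "Q1 (d + 3) = f i" using ev by metis
      have Q1: "Q1 (d + 1) = L + i" using 2(2) Q(2) by simp
      let ?N = "N(L + i := f i)"
      have "steps (Store (d + 1) (d + 3)) (Q1, N) (1 + (L + i) + f i) (Q1, ?N)"
        using steps_Store[of "d + 1" "d + 3" Q1 N] Q1 2(3) by simp
      from steps_Seq[OF 2(1) this]
      have "steps (Seq (compile e (d + 3)) (Store (d + 1) (d + 3))) (Q, N) (E + (1 + E + E)) (Q1, ?N)"
        by (rule steps_mono) (use E le f_le[OF i] i in linarith)
      moreover have "J1 (Suc i) ?N" using N unfolding J1_def by auto
      ultimately show "\<exists>R' M'. steps (Seq (compile e (d + 3)) (Store (d + 1) (d + 3))) (Q, N)
          (E + (1 + E + E)) (R', M') \<and> J1 (Suc i) M' \<and> (\<forall>r<d + 3. R' r = Q r)"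
        using 2(2) by blast
    qed (use d in \<open>auto simp: J1_def\<close>)
    then obtain R3 M3 where s2: "steps (WhileNZ (d + 2) (Seq (Seq (compile e (d + 3)) (Store (d + 1) (d + 3))) (advance d)))
      (?R2, M) ((n + 1) * ((E + (1 + E + E)) + (8 + 0 + L + 3 * n) + n + 1)) (R3, M3)" and J3: "J1 n M3"
      and R3': "\<forall>r\<le>d. r \<noteq> 1 \<longrightarrow> R3 r = ?R2 r" by blast
    have R3: "R3 0 = L" "R3 d = n" using R3' 1(3,4) d by (auto simp: R_def)
    have M3: "M3 a = (if a < L then M a else if a < L + n then f (a - L) else 0)" for a
      using J3 unfolding J1_def by (auto simp: M_def L_def)
    have M3_le: "M3 a \<le> E" for a
    proof -
      have "M a \<le> E" using M_le[of a] D(1) E(1) by linarith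
      then show ?thesis unfolding M3 using f_le by auto
    qed
    let ?R4 = "R3(d + 1 := L, d + 2 := n, 1 := 0)"
    have s3: "steps (rewind d) (R3, M3) (5 + L + n) (?R4, M3)"
      using steps_rewind[OF d, of R3 M3] R3 by simp
    \<comment> \<open>Moving upwards is safe even if source and target overlap: before round
      \<open>i\<close> only cells below \<open>i\<close> have been overwritten, and the source cell
      is \<open>L + i\<close>.\<close>
    define J2 where "J2 i N \<longleftrightarrow> N = (\<lambda>a. if a < i then f a else M3 a)" for i N
    have "\<exists>R' M'. steps (WhileNZ (d + 2) (Seq (Seq (Load (d + 3) (d + 1)) (Store 1 (d + 3))) (advance d)))
      (?R4, M3) ((n + 1) * (((1 + E + E) + (1 + E + E)) + (8 + 0 + L + 3 * n) + n + 1)) (R', M') \<and>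
      J2 n M' \<and> R' 1 = 0 + n \<and> R' (d + 1) = L + n \<and> (\<forall>r\<le>d. r \<noteq> 1 \<longrightarrow> R' r = ?R4 r)"
    proof (rule steps_pointer_loop[OF d])
      fix i Q N assume i: "i < n" and N: "J2 i N" and Q: "Q 1 = 0 + i" "Q (d + 1) = L + i"
      have Nf: "N (L + i) = f i" using N i unfolding J2_def by (auto simp: M3)
      let ?Q1 = "Q(d + 3 := f i)"
      let ?N = "N(i := f i)"
      have "steps (Load (d + 3) (d + 1)) (Q, N) (1 + (L + i) + f i) (?Q1, N)"
        using steps_Load[of "d + 3" "d + 1" Q N] Q Nf by simp
      moreover have "steps (Store 1 (d + 3)) (?Q1, N) (1 + i + f i) (?Q1, ?N)"
        using steps_Store[of 1 "d + 3" ?Q1 N] Q d by simp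
      ultimately have "steps (Seq (Load (d + 3) (d + 1)) (Store 1 (d + 3))) (Q, N)
          ((1 + (L + i) + f i) + (1 + i + f i)) (?Q1, ?N)" by (rule steps_Seq)
      then have "steps (Seq (Load (d + 3) (d + 1)) (Store 1 (d + 3))) (Q, N)
          ((1 + E + E) + (1 + E + E)) (?Q1, ?N)"
        by (rule steps_mono) (use le f_le[OF i] i in linarith)
      moreover have "J2 (Suc i) ?N" using N unfolding J2_def by auto
      ultimately show "\<exists>R' M'. steps (Seq (Load (d + 3) (d + 1)) (Store 1 (d + 3))) (Q, N)
          ((1 + E + E) + (1 + E + E)) (R', M') \<and> J2 (Suc i) M' \<and> (\<forall>r<d + 3. R' r = Q r)"
        by (intro exI[of _ ?Q1] exI[of _ ?N]) simp
    qed (use d in \<open>auto simp: J2_def\<close>)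
    then obtain R5 M5 where s4: "steps (WhileNZ (d + 2) (Seq (Seq (Load (d + 3) (d + 1)) (Store 1 (d + 3))) (advance d)))
      (?R4, M3) ((n + 1) * (((1 + E + E) + (1 + E + E)) + (8 + 0 + L + 3 * n) + n + 1)) (R5, M5)"
      and J5: "J2 n M5" and R5': "R5 1 = n" "R5 (d + 1) = L + n" "\<forall>r\<le>d. r \<noteq> 1 \<longrightarrow> R5 r = ?R4 r" by auto
    have R5: "R5 0 = L" "R5 d = n" "R5 1 = n" "R5 (d + 1) = L + n" using R5' R3 d by auto
    have M5: "M5 a = (if a < n then f a else if L + n \<le> a then 0 else M3 a)" for a
      using J5 M3[of a] unfolding J2_def by auto
    let ?R6 = "R5(d + 2 := L)"
    have s5: "steps (Const (d + 2) 0) (R5, M5) (1 + 0) (R5(d + 2 := 0), M5)"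
      "steps (Add (d + 2) (d + 2) 0) (R5(d + 2 := 0), M5) (1 + 0 + L) (?R6, M5)"
      using steps_Const[of "d + 2" 0 R5 M5] steps_Add[of "d + 2" "d + 2" 0 "R5(d + 2 := 0)" M5] R5
      by simp_all
    \<comment> \<open>Behind the moved output only the \<open>L\<close> cells from \<open>n\<close>
      on can still be nonzero.\<close>
    define J3 where "J3 i N \<longleftrightarrow> N = (\<lambda>a. if n \<le> a \<and> a < n + i then 0 else M5 a)" for i N
    have "\<exists>R' M'. steps (WhileNZ (d + 2) (Seq (Seq (Const (d + 3) 0) (Store 1 (d + 3))) (advance d)))
      (?R6, M5) ((L + 1) * (((1 + 0) + (1 + E)) + (8 + n + (L + n) + 3 * L) + L + 1)) (R', M') \<and>
      J3 L M' \<and> R' 1 = n + L \<and> R' (d + 1) = L + n + L \<and> (\<forall>r\<le>d. r \<noteq> 1 \<longrightarrow> R' r = ?R6 r)"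
    proof (rule steps_pointer_loop[OF d])
      fix i and Q N :: "nat \<Rightarrow> nat" assume i: "i < L" and N: "J3 i N" and Q: "Q 1 = n + i"
      let ?Q1 = "Q(d + 3 := 0)"
      let ?N = "N(n + i := 0)"
      have "steps (Const (d + 3) 0) (Q, N) (1 + 0) (?Q1, N)"
        using steps_Const[of "d + 3" 0 Q N] by simp
      moreover have "steps (Store 1 (d + 3)) (?Q1, N) (1 + (n + i)) (?Q1, ?N)"
        using steps_Store[of 1 "d + 3" ?Q1 N] Q d by simp
      ultimately have "steps (Seq (Const (d + 3) 0) (Store 1 (d + 3))) (Q, N)
          ((1 + 0) + (1 + (n + i))) (?Q1, ?N)" by (rule steps_Seq)
      then have "steps (Seq (Const (d + 3) 0) (Store 1 (d + 3))) (Q, N)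
          ((1 + 0) + (1 + E)) (?Q1, ?N)"
        by (rule steps_mono) (use le i in linarith)
      moreover have "J3 (Suc i) ?N" using N unfolding J3_def by auto
      ultimately show "\<exists>R' M'. steps (Seq (Const (d + 3) 0) (Store 1 (d + 3))) (Q, N)
          ((1 + 0) + (1 + E)) (R', M') \<and> J3 (Suc i) M' \<and> (\<forall>r<d + 3. R' r = Q r)"
        by (intro exI[of _ ?Q1] exI[of _ ?N]) simp
    qed (use d R5 in \<open>auto simp: J3_def\<close>)
    then obtain R7 M7 where s6: "steps (WhileNZ (d + 2) (Seq (Seq (Const (d + 3) 0) (Store 1 (d + 3))) (advance d)))
      (?R6, M5) ((L + 1) * (((1 + 0) + (1 + E)) + (8 + n + (L + n) + 3 * L) + L + 1)) (R7, M7)"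
      and J7: "J3 L M7" and R7': "\<forall>r\<le>d. r \<noteq> 1 \<longrightarrow> R7 r = ?R6 r" by auto
    have R7: "R7 d = n" using R7' R5 d by auto
    have M7: "M7 a = (if a < n then f a else 0)" for a
      using J7 unfolding J3_def by (auto simp: M5)
    then have M7: "M7 = memory (transduce len e xs)" unfolding ys by auto
    have s7: "steps (Const 0 0) (R7, M7) (1 + 0) (R7(0 := 0), M7)"
      "steps (Add 0 0 d) (R7(0 := 0), M7) (1 + 0 + n) (R7(0 := n), M7)"
      using steps_Const[of 0 0 R7 M7] steps_Add[of 0 0 d "R7(0 := 0)" M7] R7 d
      by simp_all
    note main = steps_Seq[OF 1(2) steps_Seq[OF s1 steps_Seq[OF s2 steps_Seq[OF s3 steps_Seq[OF s4
      steps_Seq[OF s5(1) steps_Seq[OF s5(2) steps_Seq[OF s6 steps_Seq[OF s7(1,2)]]]]]]]]]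
    let ?W = "Suc (top_reg ?main)"
    let ?R8 = "R7(0 := n)"
    have run: "steps ?main (R, M) (B ^ kl + (5 + L + n + ((n + 1) * ((E + (1 + E + E)) + (8 + 0 + L + 3 * n) + n + 1) +
      (5 + L + n + ((n + 1) * (((1 + E + E) + (1 + E + E)) + (8 + 0 + L + 3 * n) + n + 1) +
      (1 + 0 + (1 + 0 + L + ((L + 1) * (((1 + 0) + (1 + E)) + (8 + n + (L + n) + 3 * L) + L + 1) +
      (1 + 0 + (1 + 0 + n)))))))))) (?R8, M7)"
      unfolding transducer_main_def by (rule main)
    have "?R8 r = 0" if "?W < r" for r
      using steps_unwritten[OF run, of r] that by (simp add: R_def)
    then have "(\<lambda>r. if r \<in> {1..?W} then 0 else ?R8 r) = (\<lambda>_. 0)(0 := n)"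
      by (auto simp: fun_eq_iff not_le)
    then have final: "(\<lambda>r. if r \<in> {1..?W} then 0 else ?R8 r, M7) = initial (transduce len e xs)"
      using M7 by (simp add: initial_def) (simp add: ys)
    have E2: "E * E = B ^ (2 * ?k)"
      unfolding E_def D_def power_mult[symmetric] mult_2 power_add ..
    have EE: "E \<le> E * E" using E(3) by simp
    have c1: "(n + 1) * ((E + (1 + E + E)) + (8 + 0 + L + 3 * n) + n + 1) \<le> (2 * E) * (30 * E)"
      by (rule mult_mono) (use le E(3) in linarith)+
    have c2: "(n + 1) * (((1 + E + E) + (1 + E + E)) + (8 + 0 + L + 3 * n) + n + 1) \<le> (2 * E) * (30 * E)"
      by (rule mult_mono) (use le E(3) in linarith)+
    have c3: "(L + 1) * (((1 + 0) + (1 + E)) + (8 + n + (L + n) + 3 * L) + L + 1) \<le> (2 * E) * (30 * E)"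
      by (rule mult_mono) (use le E(3) in linarith)+
    have c: "(2 * E) * (30 * E) = 60 * (E * E)" by simp
    have W: "?W \<le> ?W * (E * E)" using mult_le_mono2[of 1 "E * E" ?W] EE E(3) by simp
    have W': "?c * (E * E) = 1999 * (E * E) + ?W * (E * E)" by (simp add: algebra_simps)
    have "steps (transducer len e d) (initial xs) (?c * (E * E)) (initial (transduce len e xs))"
      unfolding init final[symmetric] transducer_def
      by (rule steps_mono[OF steps_Seq[OF run steps_clear]], simp, unfold W')
        (use c1 c2 c3 le EE E(3) W in \<open>unfold c, linarith\<close>)
    then show ?thesis
      by (rule steps_mono) (rule const_mult_le_power[OF B], simp only: E2 order_refl)
  qed
  then show ?thesis by blast
qed

section \<open>2-clubs and the gadget graph\<close>

definition within_two :: "'a rel \<Rightarrow> 'a set \<Rightarrow> bool" where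
  "within_two A S \<longleftrightarrow>
    (\<forall>u\<in>S. \<forall>v\<in>S. u \<noteq> v \<longrightarrow> (u, v) \<in> A \<or> (\<exists>w\<in>S. (u, w) \<in> A \<and> (w, v) \<in> A))"

text \<open>A singleton family of paths is pairwise disjoint, so the task is to find one path of at
  most two arcs; between distinct vertices this is an arc or a passage through one middle
  vertex.\<close>

lemma robust_two_club_1_iff:
  assumes "pair_graph G"
  shows "robust_two_club (with_proj G) 1 S \<longleftrightarrow> S \<subseteq> pverts G \<and> within_two (parcs G) S"
proof -
  interpret pair_graph G by fact
  let ?A = "parcs G"
  have ends: "arcs_ends (with_proj G \<restriction> S) = {(a, b) \<in> ?A. a \<in> S \<and> b \<in> S}"
    by (auto simp: arcs_ends_conv)
  have "(\<exists>P. finite P \<and> card P = 1 \<and>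
        (\<forall>p\<in>P. vpath p (with_proj G \<restriction> S) \<and> hd p = u \<and> last p = v \<and> vwalk_length p \<le> 2) \<and>
        pairwise (\<lambda>p q. internal_verts p \<inter> internal_verts q = {}) P) \<longleftrightarrow>
      (u, v) \<in> ?A \<or> (\<exists>w\<in>S. (u, w) \<in> ?A \<and> (w, v) \<in> ?A)" (is "?L \<longleftrightarrow> ?R")
    if uv: "u \<in> S" "v \<in> S" "u \<noteq> v" for u v
  proof
    assume ?L
    then obtain p where p: "vpath p (with_proj G \<restriction> S)" "hd p = u" "last p = v" "vwalk_length p \<le> 2"
      by (auto simp: card_1_singleton_iff)
    from p(1) have ne: "p \<noteq> []" "set p \<subseteq> S" "set (vwalk_arcs p) \<subseteq> {(a, b) \<in> ?A. a \<in> S \<and> b \<in> S}"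
      by (auto simp: vpath_def vwalk_def ends)
    from ne(1) p(2) obtain q where q: "p = u # q" by (cases p) auto
    with p(3) uv(3) obtain w r where r: "q = w # r" by (cases q) auto
    show ?R
    proof (cases r)
      case Nil
      with q r p(3) ne(3) show ?thesis by auto
    next
      case (Cons x r')
      with p(4) q r have "r' = []" by simp
      with Cons q r p(3) ne show ?thesis by auto
    qed
  next
    assume ?R
    then obtain p where "vpath p (with_proj G \<restriction> S)" "hd p = u" "last p = v" "vwalk_length p \<le> 2"
    proof (elim disjE bexE conjE)
      assume "(u, v) \<in> ?A"
      then show ?thesis using uv
        by (intro that[of "[u, v]"]) (auto simp: vpath_def vwalk_def ends)
    next
      fix w assume "w \<in> S" "(u, w) \<in> ?A" "(w, v) \<in> ?A"
      \<comment> \<open>Loop-freeness makes the three vertices distinct, as a path requires.\<close>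
      moreover from this have "u \<noteq> w" "w \<noteq> v" using pair_no_loops[of "(u, w)"] pair_no_loops[of "(w, v)"] by auto
      ultimately show ?thesis using uv
        by (intro that[of "[u, w, v]"]) (auto simp: vpath_def vwalk_def ends)
    qed
    then show ?L by (intro exI[of _ "{p}"]) auto
  qed
  then show ?thesis unfolding robust_two_club_def within_two_def by auto
qed

text \<open>Inside the finite \<open>S\<close> only the empty set has cardinality 0, and as a proper
  subset it exists only for nonempty \<open>S\<close>. For empty \<open>S\<close> both sides hold
  trivially.\<close>

lemma hereditary_two_club_0_iff:
  assumes "pair_graph G"
  shows "hereditary_two_club (with_proj G) 0 S \<longleftrightarrow> S \<subseteq> pverts G \<and> within_two (parcs G) S"
proof -
  interpret pair_graph G by fact
  let ?A = "parcs G"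
  interpret H: wf_digraph "with_proj G \<restriction> S"
    by unfold_locales auto
  have cost: "H.awalk_cost (\<lambda>_. 1) p = length p" for p
    by (induction p) auto
  have short: "H.\<mu> (\<lambda>_. 1) u v \<le> 2 \<longleftrightarrow> u = v \<or> (u, v) \<in> ?A \<or> (\<exists>w\<in>S. (u, w) \<in> ?A \<and> (w, v) \<in> ?A)"
    (is "_ \<longleftrightarrow> ?R") if uv: "u \<in> S" "v \<in> S" for u v
  proof
    assume "H.\<mu> (\<lambda>_. 1) u v \<le> 2"
    \<comment> \<open>The distance is an infimum; passing to a strict bound yields an actual
      walk.\<close>
    then have "H.\<mu> (\<lambda>_. 1) u v < 3" by (rule order_le_less_trans) simp
    then obtain p where p: "H.awalk u p v" "length p < 3"
      unfolding H.\<mu>_def INF_less_iff cost by auto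
    consider "p = []" | e where "p = [e]" | e f where "p = [e, f]"
      using p(2) by (auto simp: less_Suc_eq numeral_3_eq_3 length_Suc_conv)
    then show ?R
      using p(1) by cases (auto simp: H.awalk_def pre_digraph.cas.simps)
  next
    assume ?R
    then obtain p where "H.awalk u p v" "length p \<le> 2"
    proof (elim disjE bexE conjE)
      assume "u = v" then show ?thesis using uv
        by (intro that[of "[]"]) (auto simp: H.awalk_def pre_digraph.cas.simps)
    next
      assume "(u, v) \<in> ?A" then show ?thesis using uv
        by (intro that[of "[(u, v)]"]) (auto simp: H.awalk_def pre_digraph.cas.simps)
    next
      fix w assume "w \<in> S" "(u, w) \<in> ?A" "(w, v) \<in> ?A"
      then show ?thesis using uv
        by (intro that[of "[(u, w), (w, v)]"]) (auto simp: H.awalk_def pre_digraph.cas.simps)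
    qed
    from H.min_cost_le_walk_cost[OF this(1), of "\<lambda>_. 1"] this(2)
    show "H.\<mu> (\<lambda>_. 1) u v \<le> 2" unfolding cost by (auto elim!: order_trans)
  qed
  have "two_club (with_proj G) S \<longleftrightarrow> S \<subseteq> pverts G \<and> within_two ?A S"
    unfolding two_club_def diameter_def within_two_def using short by (auto simp: SUP_le_iff)
  moreover have "hereditary_two_club (with_proj G) 0 S \<longleftrightarrow>
    S \<subseteq> pverts G \<and> (S \<noteq> {} \<longrightarrow> two_club (with_proj G) S)"
    unfolding hereditary_two_club_def
    using finite_subset[OF _ pair_finite_verts, of S] by (auto dest: finite_subset)
  ultimately show ?thesis by (auto simp: within_two_def)
qed

lemma within_two_image_iff:
  assumes "inj_on f V" "A \<subseteq> V \<times> V" "S \<subseteq> V"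
  shows "within_two (map_prod f f ` A) (f ` S) \<longleftrightarrow> within_two A S"
proof -
  have edge: "(f u, f v) \<in> map_prod f f ` A \<longleftrightarrow> (u, v) \<in> A" if "u \<in> S" "v \<in> S" for u v
  proof
    assume "(f u, f v) \<in> map_prod f f ` A"
    then obtain a b where ab: "(a, b) \<in> A" "f u = f a" "f v = f b" by auto
    moreover have "u \<in> V" "v \<in> V" "a \<in> V" "b \<in> V" using that ab(1) assms(2,3) by auto
    ultimately show "(u, v) \<in> A" using assms(1) by (auto dest: inj_onD)
  qed (auto intro: rev_image_eqI)
  have eq: "f u = f v \<longleftrightarrow> u = v" if "u \<in> S" "v \<in> S" for u v
    using assms(1,3) that by (auto dest: inj_onD)
  show ?thesis
    unfolding within_two_def ball_simps bex_simps using edge eq by (simp cong: ball_cong bex_cong)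
qed

text \<open>Allows the gadget to be studied on vertices with telling names, while instances must use
  an initial segment of the numbers.\<close>

lemma ex_within_two_image_iff:
  assumes "bij_betw f V W" "A \<subseteq> V \<times> V"
  shows "(\<exists>S\<subseteq>W. within_two (map_prod f f ` A) S \<and> k \<le> card S) \<longleftrightarrow>
    (\<exists>S\<subseteq>V. within_two A S \<and> k \<le> card S)"
proof -
  have inj: "inj_on f V" and W: "W = f ` V" using assms(1) by (auto simp: bij_betw_def)
  have card: "card (f ` S) = card S" if "S \<subseteq> V" for S
    using inj that by (meson card_image inj_on_subset)
  have "(\<exists>S\<subseteq>W. P S) \<longleftrightarrow> (\<exists>S\<subseteq>V. P (f ` S))" for P
    unfolding W by (auto simp: subset_image_iff)
  then show ?thesis
    using card within_two_image_iff[OF inj assms(2)] by (auto simp: W)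
qed

section \<open>The gadget graph on named vertices\<close>

datatype vertex = Lit nat nat | Cl nat nat | Hub nat nat

text \<open>\<open>occ\<close> stands for occurrence after complementary literals of a clause have
  been dropped, which is what \<open>occ_clash\<close> records; \<open>taut\<close> marks the
  clauses that had such a pair.\<close>

locale gadget =
  fixes N m :: nat and taut :: "nat \<Rightarrow> bool" and occ :: "nat \<Rightarrow> nat \<Rightarrow> nat \<Rightarrow> bool"
  assumes occ_clash: "occ j i 0 \<Longrightarrow> occ j i 1 \<Longrightarrow> False"
begin

definition V :: "vertex set" where
  "V = (\<Union>i<N. \<Union>p<2. {Lit i p}) \<union> (\<Union>j<m. \<Union>q<2. {Cl j q}) \<union> (\<Union>p<2. \<Union>q<2. {Hub p q})"

lemma V_simps [simp]:
  "Lit i p \<in> V \<longleftrightarrow> i < N \<and> p < 2" "Cl j q \<in> V \<longleftrightarrow> j < m \<and> q < 2" "Hub p q \<in> V \<longleftrightarrow> p < 2 \<and> q < 2"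
  by (auto simp: V_def)

lemma bex_V_iff:
  "(\<exists>x\<in>V. P x) \<longleftrightarrow> (\<exists>i<N. \<exists>p<2. P (Lit i p)) \<or> (\<exists>j<m. \<exists>q<2. P (Cl j q)) \<or>
    (\<exists>p<2. \<exists>q<2. P (Hub p q))"
  unfolding V_def by blast

text \<open>The second index of \<open>Lit i p\<close> is 0 for the positive literal;
  \<open>Cl j 0\<close> and \<open>Cl j 1\<close> are the two vertices of clause \<open>j\<close>.
  Edges between literals and edges between clause vertices change the second index, and a hub sees
  only one value of it on each side. With just two values, no literal and no hub is joined to both
  \<open>Lit i 0\<close> and \<open>Lit i 1\<close>, and no clause vertex and no hub to both
  \<open>Cl j 0\<close> and \<open>Cl j 1\<close>.\<close>

fun adj :: "vertex \<Rightarrow> vertex \<Rightarrow> bool" where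
  "adj (Lit i p) (Lit j q) \<longleftrightarrow> p \<noteq> q \<and> i \<noteq> j"
| "adj (Lit i p) (Cl j q) \<longleftrightarrow> occ j i p"
| "adj (Lit i p) (Hub r s) \<longleftrightarrow> p = r"
| "adj (Cl j q) (Lit i p) \<longleftrightarrow> occ j i p"
| "adj (Cl i p) (Cl j q) \<longleftrightarrow> p \<noteq> q \<and> (i \<noteq> j \<or> taut i)"
| "adj (Cl j q) (Hub r s) \<longleftrightarrow> q = s"
| "adj (Hub r s) (Lit i p) \<longleftrightarrow> r = p"
| "adj (Hub r s) (Cl j q) \<longleftrightarrow> s = q"
| "adj (Hub r s) (Hub r' s') \<longleftrightarrow> r \<noteq> r' \<or> s \<noteq> s'"

lemma adj_sym: "adj x y \<Longrightarrow> adj y x"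
  by (cases "(x, y)" rule: adj.cases) auto

lemma adj_irrefl: "\<not> adj x x"
  by (cases x) auto

definition E :: "vertex rel" where
  "E = {(x, y). x \<in> V \<and> y \<in> V \<and> adj x y}"

fun num :: "vertex \<Rightarrow> nat" where
  "num (Lit i p) = 2 * i + p"
| "num (Cl j q) = 2 * N + 2 * j + q"
| "num (Hub p q) = 2 * N + 2 * m + 2 * p + q"

lemma num_bij: "bij_betw num V {..<2 * N + 2 * m + 4}"
proof (rule bij_betw_imageI)
  have half: "i = j \<and> p = q" if "2 * i + p = 2 * j + q" "p < 2" "q < 2" for i j p q :: nat
    using that by presburger
  show "inj_on num V"
  proof (rule inj_onI)
    fix x y assume "x \<in> V" "y \<in> V" "num x = num y"
    then show "x = y"
      by (cases "(x, y)" rule: adj.cases) (auto dest: half)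
  qed
  show "num ` V = {..<2 * N + 2 * m + 4}"
  proof
    show "num ` V \<subseteq> {..<2 * N + 2 * m + 4}" by (auto simp: V_def)
    show "{..<2 * N + 2 * m + 4} \<subseteq> num ` V"
    proof
      fix u assume u: "u \<in> {..<2 * N + 2 * m + 4}"
      let ?w = "u - 2 * N - 2 * m"
      consider "u < 2 * N" | "2 * N \<le> u" "u < 2 * N + 2 * m" | "2 * N + 2 * m \<le> u" by linarith
      then show "u \<in> num ` V"
      proof cases
        case 1
        then show ?thesis by (intro image_eqI[of _ _ "Lit (u div 2) (u mod 2)"]) auto
      next
        case 2
        then show ?thesis
          by (intro image_eqI[of _ _ "Cl ((u - 2 * N) div 2) ((u - 2 * N) mod 2)"]) auto
      next
        case 3
        then show ?thesis using u by (intro image_eqI[of _ _ "Hub (?w div 2) (?w mod 2)"]) auto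
      qed
    qed
  qed
qed

lemma finite_V: "finite V"
  and card_V: "card V = 2 * N + 2 * m + 4"
  using bij_betw_finite[OF num_bij] bij_betw_same_card[OF num_bij] by simp_all

text \<open>\<open>\<sigma> i\<close> is the second index of the literal of variable
  \<open>i\<close> that is kept, so the value 0 stands for true.\<close>

definition chosen :: "(nat \<Rightarrow> nat) \<Rightarrow> vertex set" where
  "chosen \<sigma> = V - (\<lambda>i. Lit i (1 - \<sigma> i)) ` {..<N}"

lemma card_chosen: "N + 2 * m + 4 \<le> card (chosen \<sigma>)"
proof -
  have "card V - card ((\<lambda>i. Lit i (1 - \<sigma> i)) ` {..<N}) \<le> card (chosen \<sigma>)"
    unfolding chosen_def by (rule diff_card_le_card_Diff) simp
  moreover have "card ((\<lambda>i. Lit i (1 - \<sigma> i)) ` {..<N}) \<le> N"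
    using card_image_le[of "{..<N}"] by simp
  ultimately show ?thesis using card_V by linarith
qed

lemma chosen_simps:
  assumes "\<And>i. \<sigma> i < 2"
  shows "Lit i p \<in> chosen \<sigma> \<longleftrightarrow> i < N \<and> p = \<sigma> i"
    "Cl j q \<in> chosen \<sigma> \<longleftrightarrow> j < m \<and> q < 2" "Hub p q \<in> chosen \<sigma> \<longleftrightarrow> p < 2 \<and> q < 2"
proof -
  from assms[of i] consider "\<sigma> i = 0" | "\<sigma> i = 1" by linarith
  then show "Lit i p \<in> chosen \<sigma> \<longleftrightarrow> i < N \<and> p = \<sigma> i"
    by cases (auto simp: chosen_def image_iff)
qed (simp_all add: chosen_def image_iff)

text \<open>A hub is the middle vertex for two literals or two clause vertices with equal second
  index, and for a literal with a clause vertex; a hub itself reaches every vertex not adjacent to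
  it through another hub. The other pairs are adjacent, with one exception: the two vertices of a
  clause that is not \<open>taut\<close>, which meet at a kept literal of the clause.\<close>

lemma within_two_chosen:
  assumes \<sigma>: "\<And>i. \<sigma> i < 2" and sat: "\<forall>j<m. taut j \<or> (\<exists>i<N. occ j i (\<sigma> i))"
  shows "within_two E (chosen \<sigma>)"
  unfolding within_two_def
proof (intro ballI impI)
  fix x y assume xy: "x \<in> chosen \<sigma>" "y \<in> chosen \<sigma>" "x \<noteq> y"
  note [simp] = chosen_simps[of \<sigma>, OF \<sigma>]
  have V: "z \<in> V" if "z \<in> chosen \<sigma>" for z using that by (simp add: chosen_def)
  define near where "near \<longleftrightarrow> (x, y) \<in> E \<or> (\<exists>w\<in>chosen \<sigma>. (x, w) \<in> E \<and> (w, y) \<in> E)"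
  have via: near if "z \<in> chosen \<sigma>" "adj x z" "adj z y" for z
    unfolding near_def by (intro disjI2 bexI[of _ z]) (use that xy V in \<open>simp_all add: E_def\<close>)
  have direct: near if "adj x y"
    unfolding near_def by (rule disjI1) (use that xy V in \<open>simp add: E_def\<close>)
  have near
  proof (cases "(x, y)" rule: adj.cases)
    case (1 i p j q)
    \<comment> \<open>Kept literals with different second index belong to different variables and
      are therefore adjacent.\<close>
    with xy \<sigma> show ?thesis by (cases "p = q") (auto intro: direct via[of "Hub p 0"])
  next
    case (2 i p j q)
    with xy \<sigma> show ?thesis by (auto intro: via[of "Hub p q"])
  next
    case (3 i p r s)
    with xy \<sigma>[of i] show ?thesis
      by (cases "p = r") (auto intro: direct via[of "Hub p s"])
  next
    case (4 j q i p)
    with xy \<sigma> show ?thesis by (auto intro: via[of "Hub p q"])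
  next
    case (5 i p j q)
    show ?thesis
    proof (cases "p = q")
      case True
      with 5 xy show ?thesis by (auto intro: via[of "Hub 0 p"])
    next
      case False
      show ?thesis
      proof (cases "i \<noteq> j \<or> taut i")
        case True
        with False 5 show ?thesis by (auto intro: direct)
      next
        case False
        with sat 5 xy obtain k where "k < N" "occ i k (\<sigma> k)" by auto
        with False 5 show ?thesis by (auto intro: via[of "Lit k (\<sigma> k)"])
      qed
    qed
  next
    case (6 j q r s)
    with xy show ?thesis by (cases "q = s") (auto intro: direct via[of "Hub r q"])
  next
    case (7 r s i p)
    with xy \<sigma>[of i] show ?thesis by (cases "p = r") (auto intro: direct via[of "Hub p s"])
  next
    case (8 r s j q)
    with xy show ?thesis by (cases "q = s") (auto intro: direct via[of "Hub r q"])
  next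
    case (9 r s r' s')
    with xy show ?thesis by (auto intro: direct)
  qed
  then show "(x, y) \<in> E \<or> (\<exists>w\<in>chosen \<sigma>. (x, w) \<in> E \<and> (w, y) \<in> E)"
    unfolding near_def .
qed

text \<open>
  Complementary literals are too far apart, so at least one vertex of each of the \<open>N\<close> pairs is
  deleted; the budget \<open>N\<close> then leaves all other vertices in place.
\<close>

lemma sat_if_within_two:
  assumes S: "S \<subseteq> V" "within_two E S" "N + 2 * m + 4 \<le> card S"
  obtains \<sigma> where "\<And>i. \<sigma> i < 2" "\<forall>j<m. taut j \<or> (\<exists>i<N. occ j i (\<sigma> i))"
proof -
  have no_pair: "\<not> (Lit i 0 \<in> S \<and> Lit i 1 \<in> S)" for i
  proof
    assume *: "Lit i 0 \<in> S \<and> Lit i 1 \<in> S"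
    with S(2)[unfolded within_two_def, rule_format, of "Lit i 0" "Lit i 1"]
    obtain w where "w \<in> V" "adj (Lit i 0) w" "adj w (Lit i 1)" by (auto simp: E_def)
    then show False using occ_clash by (cases w) auto
  qed
  define out where "out i = (if Lit i 0 \<in> S then Lit i 1 else Lit i 0)" for i
  have "inj_on out {..<N}" by (auto simp: inj_on_def out_def split: if_splits)
  then have "card (out ` {..<N}) = N" by (simp add: card_image)
  moreover have sub: "out ` {..<N} \<subseteq> V - S" using no_pair by (auto simp: out_def)
  moreover have "card (V - S) \<le> N"
    using S finite_V card_V by (simp add: card_Diff_subset finite_subset)
  ultimately have out: "out ` {..<N} = V - S"
    using finite_V by (intro card_seteq) auto
  have Cl: "Cl j q \<in> S" if "j < m" "q < 2" for j q
  proof (rule ccontr)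
    assume "Cl j q \<notin> S"
    with that have "Cl j q \<in> out ` {..<N}" unfolding out by simp
    then show False by (auto simp: out_def split: if_splits)
  qed
  \<comment> \<open>By \<open>no_pair\<close>, a surviving literal of variable \<open>i\<close> has
    exactly the index \<open>\<sigma> i\<close>.\<close>
  define \<sigma> :: "nat \<Rightarrow> nat" where "\<sigma> i = (if Lit i 0 \<in> S then 0 else 1)" for i
  have "taut j \<or> (\<exists>i<N. occ j i (\<sigma> i))" if j: "j < m" for j
  proof (rule disjCI)
    assume no: "\<not> (\<exists>i<N. occ j i (\<sigma> i))"
    have "adj (Cl j 0) (Cl j 1) \<or> (\<exists>w\<in>S. adj (Cl j 0) w \<and> adj w (Cl j 1))"
      using S(2)[unfolded within_two_def, rule_format, of "Cl j 0" "Cl j 1"] Cl[OF j, of 0] Cl[OF j, of 1]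
      by (auto simp: E_def)
    then show "taut j"
    proof
      assume "\<exists>w\<in>S. adj (Cl j 0) w \<and> adj w (Cl j 1)"
      then obtain w where w: "w \<in> S" "adj (Cl j 0) w" "adj w (Cl j 1)" by blast
      show "taut j"
      proof (cases w)
        case (Lit i p)
        with w S(1) have "i < N" "p < 2" "occ j i p" "Lit i p \<in> S" by auto
        moreover from this have "p = \<sigma> i" using no_pair[of i] by (auto simp: \<sigma>_def less_2_cases_iff)
        ultimately show ?thesis using no by blast
      qed (use w S(1) in auto)
    qed simp
  qed
  then show thesis by (intro that[of \<sigma>]) (auto simp: \<sigma>_def)
qed

section \<open>The gadget graph on an initial segment of the natural numbers\<close>

definition graph :: "nat pair_pre_digraph" where
  "graph = \<lparr> pverts = {..<2 * N + 2 * m + 4}, parcs = map_prod num num ` E \<rparr>"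

lemma graph_simps [simp]:
  "pverts graph = {..<2 * N + 2 * m + 4}" "parcs graph = map_prod num num ` E"
  by (simp_all add: graph_def)

lemma pair_graph_graph: "pair_graph graph"
proof -
  have num: "num x < 2 * N + 2 * m + 4" if "x \<in> V" for x
    using that bij_betwE[OF num_bij] by simp
  have inj: "x = y" if "num x = num y" "x \<in> V" "y \<in> V" for x y
    using that num_bij by (auto simp: bij_betw_def inj_on_def)
  have "finite E" using finite_subset[of E "V \<times> V"] finite_V by (auto simp: E_def)
  moreover have "symmetric (with_proj graph)"
    unfolding symmetric_def sym_def by (force simp: E_def intro: adj_sym)
  ultimately show ?thesis
    by unfold_locales (auto simp: E_def num adj_irrefl dest!: inj)
qed

lemma ex_within_two_graph_iff:
  "(\<exists>S\<subseteq>pverts graph. within_two (parcs graph) S \<and> N + 2 * m + 4 \<le> card S) \<longleftrightarrow>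
    (\<exists>\<sigma>. (\<forall>i. \<sigma> i < (2::nat)) \<and> (\<forall>j<m. taut j \<or> (\<exists>i<N. occ j i (\<sigma> i))))"
proof -
  have "E \<subseteq> V \<times> V" by (auto simp: E_def)
  note ex_within_two_image_iff[OF num_bij this, of "N + 2 * m + 4"]
  moreover have "(\<exists>S\<subseteq>V. within_two E S \<and> N + 2 * m + 4 \<le> card S) \<longleftrightarrow>
    (\<exists>\<sigma>. (\<forall>i. \<sigma> i < (2::nat)) \<and> (\<forall>j<m. taut j \<or> (\<exists>i<N. occ j i (\<sigma> i))))"
    (is "?L \<longleftrightarrow> ?R")
  proof
    assume ?L
    then obtain S where "S \<subseteq> V" "within_two E S" "N + 2 * m + 4 \<le> card S" by blast
    then show ?R by (rule sat_if_within_two) blast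
  next
    assume ?R
    then obtain \<sigma> where "\<And>i. \<sigma> i < 2" "\<forall>j<m. taut j \<or> (\<exists>i<N. occ j i (\<sigma> i))" by blast
    from within_two_chosen[OF this] card_chosen[of \<sigma>] show ?L
      by (intro exI[of _ "chosen \<sigma>"]) (auto simp: chosen_def)
  qed
  ultimately show ?thesis by simp
qed

end

section \<open>Computing the reduction\<close>

definition contains :: "clause list \<Rightarrow> nat \<Rightarrow> nat \<Rightarrow> bool" where
  "contains F j l \<longleftrightarrow> l \<in> lit_code ` set (F ! j)"

definition tautology :: "cnf \<Rightarrow> nat \<Rightarrow> bool" where
  "tautology \<phi> j \<longleftrightarrow> (\<exists>i<fst \<phi>. contains (snd \<phi>) j (2 * i) \<and> contains (snd \<phi>) j (2 * i + 1))"

definition occurs :: "cnf \<Rightarrow> nat \<Rightarrow> nat \<Rightarrow> nat \<Rightarrow> bool" where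
  "occurs \<phi> j i p \<longleftrightarrow> contains (snd \<phi>) j (2 * i + p) \<and> \<not> contains (snd \<phi>) j (2 * i + (1 - p))"

lemma lit_code_eq_iff: "p < 2 \<Longrightarrow> lit_code l = 2 * i + p \<longleftrightarrow> l = (if p = 0 then Pos i else Neg i)"
  by (cases l; auto simp: less_2_cases_iff; presburger)

text \<open>Dropping complementary pairs loses nothing: if the true literal of a clause has been
  dropped, the clause contains its complement as well and is a tautology.\<close>

lemma satisfiable_iff:
  assumes "\<phi> \<in> cnf_instances"
  shows "satisfiable \<phi> \<longleftrightarrow> (\<exists>\<sigma>. (\<forall>i. \<sigma> i < (2::nat)) \<and>
    (\<forall>j<length (snd \<phi>). tautology \<phi> j \<or> (\<exists>i<fst \<phi>. occurs \<phi> j i (\<sigma> i))))" (is "_ \<longleftrightarrow> ?R")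
proof
  assume "satisfiable \<phi>"
  then obtain \<sigma> where \<sigma>: "\<forall>C\<in>set (snd \<phi>). \<exists>l\<in>set C. lit_true \<sigma> l" unfolding satisfiable_def ..
  \<comment> \<open>Truth becomes 0 because \<open>lit_code\<close> gives positive literals the
    offset 0.\<close>
  define s :: "nat \<Rightarrow> nat" where "s i = (if \<sigma> i then 0 else 1)" for i
  have "tautology \<phi> j \<or> (\<exists>i<fst \<phi>. occurs \<phi> j i (s i))" if j: "j < length (snd \<phi>)" for j
  proof (rule disjCI)
    assume no: "\<not> (\<exists>i<fst \<phi>. occurs \<phi> j i (s i))"
    from \<sigma> j obtain l where l: "l \<in> set (snd \<phi> ! j)" "lit_true \<sigma> l" by (meson nth_mem)
    have "\<forall>C\<in>set (snd \<phi>). \<forall>l\<in>set C. var l < fst \<phi>"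
      using assms by (auto simp: cnf_instances_def)
    with nth_mem[OF j] l(1) have v: "var l < fst \<phi>" by blast
    have code: "lit_code l = 2 * var l + s (var l)" using l(2) by (cases l) (auto simp: s_def)
    then have 1: "contains (snd \<phi>) j (2 * var l + s (var l))"
      using l(1) unfolding contains_def by force
    moreover have "contains (snd \<phi>) j (2 * var l + (1 - s (var l)))"
      using no v 1 unfolding occurs_def by blast
    ultimately show "tautology \<phi> j"
      using v unfolding tautology_def by (intro exI[of _ "var l"]) (auto simp: s_def split: if_splits)
  qed
  then show ?R by (intro exI[of _ s]) (simp add: s_def)
next
  assume ?R
  then obtain s where s: "\<And>i. s i < (2::nat)"
    and sat: "\<And>j. j < length (snd \<phi>) \<Longrightarrow> tautology \<phi> j \<or> (\<exists>i<fst \<phi>. occurs \<phi> j i (s i))" by blast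
  have "\<exists>l\<in>set C. lit_true (\<lambda>i. s i = 0) l" if C: "C \<in> set (snd \<phi>)" for C
  proof -
    from C obtain j where j: "j < length (snd \<phi>)" "C = snd \<phi> ! j" by (metis in_set_conv_nth)
    have "\<exists>i. contains (snd \<phi>) j (2 * i + s i)"
    proof (cases "tautology \<phi> j")
      case True
      then obtain i where "contains (snd \<phi>) j (2 * i)" "contains (snd \<phi>) j (2 * i + 1)"
        unfolding tautology_def by blast
      then show ?thesis using s[of i] by (intro exI[of _ i]) (auto simp: less_2_cases_iff)
    next
      case False
      with sat[OF j(1)] show ?thesis unfolding occurs_def by blast
    qed
    then obtain i l where "l \<in> set C" "lit_code l = 2 * i + s i"
      unfolding contains_def j(2) by (metis imageE)
    with lit_code_eq_iff[OF s[of i]] show ?thesis by (intro bexI[of _ l]) auto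
  qed
  then show "satisfiable \<phi>" unfolding satisfiable_def by blast
qed

section \<open>Positions in the encoding of a formula\<close>

lemma nth_concat:
  assumes "j < length xss" "t < length (xss ! j)"
  shows "(\<Sum>i<j. length (xss ! i)) + t < length (concat xss) \<and>
    concat xss ! ((\<Sum>i<j. length (xss ! i)) + t) = xss ! j ! t"
  using assms
proof (induction xss arbitrary: j)
  case (Cons xs xss)
  show ?case
  proof (cases j)
    case (Suc k)
    with Cons show ?thesis by (auto simp: sum.lessThan_Suc_shift nth_append ac_simps simp del: sum.lessThan_Suc)
  qed (use Cons in \<open>auto simp: nth_append\<close>)
qed simp

text \<open>The 2 skips the header with \<open>N\<close> and the number of clauses; the 1 is the
  length entry in front of each clause.\<close>

definition clause_pos :: "clause list \<Rightarrow> nat \<Rightarrow> nat" where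
  "clause_pos F j = 2 + (\<Sum>i<j. 1 + length (F ! i))"

lemma nth_cnf_encode:
  assumes "j < length F"
  shows "clause_pos F j < length (cnf_encode (N, F))"
    "cnf_encode (N, F) ! clause_pos F j = length (F ! j)"
    "t < length (F ! j) \<Longrightarrow> clause_pos F j + 1 + t < length (cnf_encode (N, F))"
    "t < length (F ! j) \<Longrightarrow> cnf_encode (N, F) ! (clause_pos F j + 1 + t) = lit_code (F ! j ! t)"
proof -
  let ?xss = "map (\<lambda>C. length C # map lit_code C) F"
  have pos: "clause_pos F j = 2 + (\<Sum>i<j. length (?xss ! i))"
    using assms by (simp add: clause_pos_def)
  have *: "clause_pos F j + t < length (cnf_encode (N, F)) \<and>
    cnf_encode (N, F) ! (clause_pos F j + t) = ?xss ! j ! t" if "t \<le> length (F ! j)" for t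
    using nth_concat[of j ?xss t] assms that unfolding pos by simp
  from *[of 0] assms show "clause_pos F j < length (cnf_encode (N, F))"
    "cnf_encode (N, F) ! clause_pos F j = length (F ! j)" by simp_all
  assume "t < length (F ! j)"
  with *[of "1 + t"] assms show "clause_pos F j + 1 + t < length (cnf_encode (N, F))"
    "cnf_encode (N, F) ! (clause_pos F j + 1 + t) = lit_code (F ! j ! t)" by simp_all
qed

section \<open>Conditions and bounded searches as expressions\<close>

definition holds :: "(nat \<Rightarrow> nat) \<Rightarrow> (nat \<Rightarrow> nat) \<Rightarrow> exp \<Rightarrow> bool" where
  "holds M R e \<longleftrightarrow> eval M R e \<noteq> 0"

definition NotE :: "exp \<Rightarrow> exp" where "NotE a = Ite a (Num 0) (Num 1)"
definition AndE :: "exp \<Rightarrow> exp \<Rightarrow> exp" where "AndE a b = Ite a b (Num 0)"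
definition OrE :: "exp \<Rightarrow> exp \<Rightarrow> exp" where "OrE a b = Ite a (Num 1) b"
definition EqE :: "exp \<Rightarrow> exp \<Rightarrow> exp" where "EqE a b = NotE (Plus (Minus a b) (Minus b a))"

text \<open>The iteration searches for the least witness; it stops at \<open>n\<close> if there is none.\<close>

definition ExE :: "nat \<Rightarrow> exp \<Rightarrow> exp \<Rightarrow> exp" where
  "ExE x n b = Minus n (Iter x n (Num 1) (Ite b (Num 0) (Num 1)))"

text \<open>With the increment itself as the cap, every round adds exactly \<open>b\<close>,
  provided that \<open>b\<close> does not depend on register \<open>x\<close>.\<close>

definition TimesE :: "nat \<Rightarrow> exp \<Rightarrow> exp \<Rightarrow> exp" where
  "TimesE x a b = Iter x a b b"

lemmas bool_exp_defs = NotE_def AndE_def OrE_def EqE_def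

lemma holds_simps [simp]:
  "holds M R (NotE a) \<longleftrightarrow> \<not> holds M R a"
  "holds M R (AndE a b) \<longleftrightarrow> holds M R a \<and> holds M R b"
  "holds M R (OrE a b) \<longleftrightarrow> holds M R a \<or> holds M R b"
  "holds M R (EqE a b) \<longleftrightarrow> eval M R a = eval M R b"
  by (auto simp: holds_def bool_exp_defs)

lemma funpow_search:
  fixes P :: "nat \<Rightarrow> bool"
  shows "((\<lambda>v. v + min (if P v then 0 else 1) 1) ^^ n) 0 < n \<longleftrightarrow> (\<exists>k<n. P k)"
proof -
  define r where "r n = ((\<lambda>v. v + min (if P v then 0 else 1) 1) ^^ n) (0::nat)" for n
  have "(\<forall>k<r n. \<not> P k) \<and> (r n = n \<or> r n < n \<and> P (r n))"
    unfolding r_def by (induction n) (auto simp: less_Suc_eq)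
  then have none: "\<forall>k<r n. \<not> P k" and "r n = n \<or> r n < n \<and> P (r n)" by auto
  then have "r n < n \<longleftrightarrow> (\<exists>k<n. P k)" by (metis less_irrefl)
  then show ?thesis unfolding r_def .
qed

lemma holds_ExE [simp]:
  "holds M R (ExE x n b) \<longleftrightarrow> (\<exists>k<eval M R n. holds M (R(x := k)) b)"
  unfolding funpow_search[where P = "\<lambda>v. holds M (R(x := v)) b", symmetric]
  by (simp add: holds_def ExE_def not_le cong: if_cong)

lemma eval_TimesE:
  assumes "\<And>v. eval M (R(x := v)) b = eval M R b"
  shows "eval M R (TimesE x a b) = eval M R a * eval M R b"
proof -
  have "((\<lambda>v. v + c) ^^ n) 0 = n * c" for n c :: nat by (induction n) auto
  then show ?thesis by (simp add: TimesE_def assms)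
qed

lemma scoped_exps [simp]:
  "scoped d (NotE a) \<longleftrightarrow> scoped d a \<and> 0 < d"
  "scoped d (AndE a b) \<longleftrightarrow> scoped d a \<and> scoped d b \<and> 0 < d"
  "scoped d (OrE a b) \<longleftrightarrow> scoped d a \<and> scoped d b \<and> 0 < d"
  "scoped d (EqE a b) \<longleftrightarrow> scoped d a \<and> scoped d b \<and> 0 < d"
  "scoped d (ExE x n b) \<longleftrightarrow> 0 < x \<and> x < d \<and> scoped d n \<and> scoped d b"
  "scoped d (TimesE x a b) \<longleftrightarrow> 0 < x \<and> x < d \<and> scoped d a \<and> scoped d b"
  by (auto simp: bool_exp_defs ExE_def TimesE_def)

text \<open>
  Registers: 1 holds the position in the output, 2 and 3 the two vertices, 4 and 5 (6 and 7) the
  parameters of the first (second) vertex; the others are bound locally.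
\<close>

definition "varsE = Mem (Num 0)"
definition "clausesE = Mem (Num 1)"
definition "doubleE a = Plus a a"
definition "sizeE = Plus (doubleE varsE) (Plus (doubleE clausesE) (Num 4))"
text \<open>A walk over the clauses: behind the header, the cell at the current position is the
  length of the next clause, and the added 1 passes over that length entry. The input length serves
  as the cap.\<close>

definition "posE j = Plus (Num 2) (Iter 8 (Reg j) (Reg 0) (Plus (Num 1) (Mem (Plus (Num 2) (Reg 8)))))"
definition "containsE j l = ExE 9 (Mem (posE j)) (EqE (Mem (Plus (posE j) (Plus (Num 1) (Reg 9)))) l)"
definition "occursE j i p = AndE (containsE j (Plus (doubleE (Reg i)) (Reg p)))
  (NotE (containsE j (Plus (doubleE (Reg i)) (Minus (Num 1) (Reg p)))))"
definition "tautologyE j = ExE 10 varsE (AndE (containsE j (doubleE (Reg 10)))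
  (containsE j (Plus (doubleE (Reg 10)) (Num 1))))"
text \<open>Without division, the vertex in register \<open>u\<close> is decoded by searching for
  its kind and indices; \<open>l\<close>, \<open>c\<close> and \<open>h\<close> are the conditions
  for a literal, a clause vertex and a hub, evaluated with the indices in \<open>a\<close> and
  \<open>b\<close>.\<close>

definition "vertexE u a b l c h = OrE
  (ExE a varsE (ExE b (Num 2) (AndE (EqE (Reg u) (Plus (doubleE (Reg a)) (Reg b))) l)))
  (OrE (ExE a clausesE (ExE b (Num 2)
    (AndE (EqE (Reg u) (Plus (doubleE varsE) (Plus (doubleE (Reg a)) (Reg b)))) c)))
  (ExE a (Num 2) (ExE b (Num 2) (AndE (EqE (Reg u)
    (Plus (doubleE varsE) (Plus (doubleE clausesE) (Plus (doubleE (Reg a)) (Reg b))))) h))))"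
text \<open>The nine innermost conditions are those of \<open>adj\<close>, in the same
  order.\<close>

definition "edgeE = vertexE 2 4 5
  (vertexE 3 6 7 (AndE (NotE (EqE (Reg 5) (Reg 7))) (NotE (EqE (Reg 4) (Reg 6))))
    (occursE 6 4 5) (EqE (Reg 5) (Reg 6)))
  (vertexE 3 6 7 (occursE 4 6 7)
    (AndE (NotE (EqE (Reg 5) (Reg 7))) (OrE (NotE (EqE (Reg 4) (Reg 6))) (tautologyE 4)))
    (EqE (Reg 5) (Reg 7)))
  (vertexE 3 6 7 (EqE (Reg 4) (Reg 7)) (EqE (Reg 5) (Reg 7))
    (OrE (NotE (EqE (Reg 4) (Reg 6))) (NotE (EqE (Reg 5) (Reg 7)))))"
text \<open>The nested tests separate positions 0, 1 and 2 of the output, which hold the number of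
  vertices, \<open>t\<close> and the target size, from the adjacency matrix, whose row and column
  are again found by search.\<close>

definition "entryE t = Ite (Reg 1) (Ite (Minus (Reg 1) (Num 1)) (Ite (Minus (Reg 1) (Num 2))
    (Ite (ExE 2 sizeE (ExE 3 sizeE (AndE
      (EqE (Reg 1) (Plus (Num 3) (Plus (TimesE 11 (Reg 2) sizeE) (Reg 3)))) edgeE))) (Num 1) (Num 0))
    (Plus varsE (Plus (doubleE clausesE) (Num 4)))) (Num t)) sizeE"
definition "lenE = Plus (Num 3) (TimesE 11 sizeE sizeE)"

lemmas exp_defs = varsE_def clausesE_def doubleE_def sizeE_def posE_def containsE_def occursE_def
  tautologyE_def vertexE_def edgeE_def entryE_def lenE_def

lemma scoped_entryE: "scoped 12 (entryE t)" "scoped 12 lenE"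
  by (simp_all add: exp_defs)

lemma concat_rows_eq:
  "concat (map (\<lambda>u. map (f u) [0..<k]) [0..<l]) = map (\<lambda>i. f (i div k) (i mod k)) [0..<l * k]"
proof (induction l)
  case (Suc l)
  have "map (f l) [0..<k] = map (\<lambda>i. f (i div k) (i mod k)) [l * k..<l * k + k]"
    by (rule nth_equalityI) auto
  moreover have "[0..<Suc l * k] = [0..<l * k] @ [l * k..<l * k + k]"
    using upt_add_eq_append[of 0 "l * k" k] by (simp add: add.commute)
  ultimately show ?case using Suc by simp
qed simp

section \<open>Correctness of the expressions on an encoded formula\<close>

locale cnf_formula =
  fixes N :: nat and F :: "clause list"
begin

sublocale gadget N "length F" "tautology (N, F)" "occurs (N, F)"
  by unfold_locales (auto simp: occurs_def)

definition "M = memory (cnf_encode (N, F))"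
definition "L = length (cnf_encode (N, F))"

lemma M_header [simp]: "M 0 = N" "M (Suc 0) = length F" "0 < L" "Suc 0 < L"
  by (simp_all add: M_def L_def)

lemma M_clause:
  assumes "j < length F"
  shows "clause_pos F j < L" "M (clause_pos F j) = length (F ! j)"
    "t < length (F ! j) \<Longrightarrow> clause_pos F j + 1 + t < L"
    "t < length (F ! j) \<Longrightarrow> M (clause_pos F j + 1 + t) = lit_code (F ! j ! t)"
  using nth_cnf_encode(1,2)[OF assms, where N = N] nth_cnf_encode(3,4)[OF assms, where N = N and t = t]
  unfolding M_def L_def by (simp_all del: cnf_encode.simps)

abbreviation "ready R \<equiv> R 0 = L"
abbreviation "n \<equiv> 2 * N + 2 * length F + 4"

lemma eval_consts [simp]:
  assumes "ready R"
  shows "eval M R varsE = N" "eval M R clausesE = length F" "eval M R sizeE = n"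
  using assms by (simp_all add: varsE_def clausesE_def sizeE_def doubleE_def)

lemma eval_doubleE [simp]: "eval M R (doubleE a) = 2 * eval M R a"
  by (simp add: doubleE_def)

lemma eval_posE:
  assumes "ready R" "R j \<le> length F"
  shows "eval M R (posE j) = clause_pos F (R j)"
proof -
  define g where "g v = v + min (1 + (if 2 + v < L then M (2 + v) else 0)) L" for v
  have "(g ^^ k) 0 = (\<Sum>i<k. 1 + length (F ! i))" if "k \<le> length F" for k
    using that
  proof (induction k)
    case (Suc k)
    then have k: "k < length F" by simp
    \<comment> \<open>The cap must not cut off an increment: a clause and its length entry fit into
      the encoding.\<close>
    have "1 + length (F ! k) \<le> L"
    proof (cases "length (F ! k)")
      case (Suc l)
      then show ?thesis using M_clause(3)[OF k, of l] by simp
    qed (use M_clause(1)[OF k] in simp)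
    moreover have "(if clause_pos F k < L then M (clause_pos F k) else 0) = length (F ! k)"
      using M_clause(1,2)[OF k] by simp
    ultimately have "g (\<Sum>i<k. 1 + length (F ! i)) = (\<Sum>i<k. 1 + length (F ! i)) + (1 + length (F ! k))"
      unfolding g_def clause_pos_def by simp
    with Suc show ?case by simp
  qed simp
  from this[OF assms(2)] show ?thesis
    using assms(1) by (simp add: posE_def clause_pos_def g_def[abs_def] cong: if_cong)
qed

text \<open>The search binds register 9, which must change neither the clause inspected nor the
  literal sought; hence the last two hypotheses.\<close>

lemma holds_containsE:
  assumes "ready R" "R j < length F" "j \<noteq> 9" "\<And>t. eval M (R(9 := t)) l = eval M R l"
  shows "holds M R (containsE j l) \<longleftrightarrow> contains F (R j) (eval M R l)"
proof -
  let ?p = "clause_pos F (R j)"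
  have pos: "eval M R (posE j) = ?p" "eval M (R(9 := t)) (posE j) = ?p" for t
    using eval_posE[of R j] eval_posE[of "R(9 := t)" j] assms by auto
  note nth = M_clause[OF assms(2)]
  have len: "eval M R (Mem (posE j)) = length (F ! R j)"
    using nth(1,2) assms(1) pos by (simp cong: if_cong)
  have lit: "eval M (R(9 := t)) (Mem (Plus (posE j) (Plus (Num 1) (Reg 9)))) = lit_code (F ! R j ! t)"
    if "t < length (F ! R j)" for t
    using nth(3,4)[OF that] assms(1) pos by (simp cong: if_cong)
  have "holds M R (containsE j l) \<longleftrightarrow> (\<exists>t<length (F ! R j). lit_code (F ! R j ! t) = eval M R l)"
    unfolding containsE_def holds_ExE len holds_simps
    by (intro ex_cong1 conj_cong refl) (simp del: eval.simps One_nat_def add: lit assms(4))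
  also have "\<dots> \<longleftrightarrow> contains F (R j) (eval M R l)"
    unfolding contains_def image_iff by (metis in_set_conv_nth)
  finally show ?thesis .
qed

lemma holds_occursE:
  assumes "ready R" "R j < length F" "j \<noteq> 9" "i \<noteq> 9" "p \<noteq> 9"
  shows "holds M R (occursE j i p) \<longleftrightarrow> occurs (N, F) (R j) (R i) (R p)"
  using assms by (simp add: occursE_def occurs_def holds_containsE)

lemma holds_tautologyE:
  assumes "ready R" "R j < length F" "j \<noteq> 9" "j \<noteq> 10"
  shows "holds M R (tautologyE j) \<longleftrightarrow> tautology (N, F) (R j)"
  using assms by (simp add: tautologyE_def tautology_def holds_containsE)

lemma holds_vertexE:
  assumes "ready R" "u \<noteq> a" "u \<noteq> b" "a \<noteq> b" "a \<noteq> 0" "b \<noteq> 0"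
  shows "holds M R (vertexE u a b l c h) \<longleftrightarrow> (\<exists>x\<in>V. R u = num x \<and>
    (case x of Lit i p \<Rightarrow> holds M (R(a := i, b := p)) l
      | Cl i p \<Rightarrow> holds M (R(a := i, b := p)) c
      | Hub i p \<Rightarrow> holds M (R(a := i, b := p)) h))"
  using assms unfolding vertexE_def bex_V_iff by (simp add: add.assoc)

lemma holds_edgeE:
  assumes "ready R"
  shows "holds M R edgeE \<longleftrightarrow> (R 2, R 3) \<in> parcs graph"
proof -
  \<comment> \<open>Here \<open>z\<close> is the first vertex, already decoded; the fact is used
    once for each of its three kinds.\<close>
  have second: "holds M R' (vertexE 3 6 7 l c h) \<longleftrightarrow> (\<exists>y\<in>V. R' 3 = num y \<and> adj z y)"
    if ready: "ready R'" and vals: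
      "\<And>i p. i < N \<Longrightarrow> holds M (R'(6 := i, 7 := p)) l = adj z (Lit i p)"
      "\<And>j q. j < length F \<Longrightarrow> holds M (R'(6 := j, 7 := q)) c = adj z (Cl j q)"
      "\<And>r s. holds M (R'(6 := r, 7 := s)) h = adj z (Hub r s)" for R' l c h z
  proof -
    have "(case y of Lit i p \<Rightarrow> holds M (R'(6 := i, 7 := p)) l
      | Cl i p \<Rightarrow> holds M (R'(6 := i, 7 := p)) c
      | Hub i p \<Rightarrow> holds M (R'(6 := i, 7 := p)) h) = adj z y" if "y \<in> V" for y
      using that vals by (cases y) simp_all
    then show ?thesis using ready by (simp add: holds_vertexE cong: bex_cong)
  qed
  have "holds M R edgeE \<longleftrightarrow> (\<exists>x\<in>V. R 2 = num x \<and> (\<exists>y\<in>V. R 3 = num y \<and> adj x y))"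
    unfolding edgeE_def
  proof (rule trans[OF holds_vertexE[where R = R]], goal_cases)
    case 7
    show ?case
    proof (rule bex_cong[OF refl], rule conj_cong[OF refl])
      fix x assume x: "x \<in> V"
      show "(case x of Lit i p \<Rightarrow> holds M (R(4 := i, 5 := p)) (vertexE 3 6 7
              (AndE (NotE (EqE (Reg 5) (Reg 7))) (NotE (EqE (Reg 4) (Reg 6))))
              (occursE 6 4 5) (EqE (Reg 5) (Reg 6)))
          | Cl i p \<Rightarrow> holds M (R(4 := i, 5 := p)) (vertexE 3 6 7 (occursE 4 6 7)
              (AndE (NotE (EqE (Reg 5) (Reg 7))) (OrE (NotE (EqE (Reg 4) (Reg 6))) (tautologyE 4)))
              (EqE (Reg 5) (Reg 7)))
          | Hub i p \<Rightarrow> holds M (R(4 := i, 5 := p)) (vertexE 3 6 7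
              (EqE (Reg 4) (Reg 7)) (EqE (Reg 5) (Reg 7))
              (OrE (NotE (EqE (Reg 4) (Reg 6))) (NotE (EqE (Reg 5) (Reg 7)))))) \<longleftrightarrow>
        (\<exists>y\<in>V. R 3 = num y \<and> adj x y)"
      proof (cases x)
        case (Lit i p)
        with assms show ?thesis by (simp add: second[of _ _ x] holds_occursE)
      next
        case (Cl j q)
        with assms x show ?thesis
          by (simp add: second[of _ _ x] holds_occursE holds_tautologyE)
      next
        case (Hub r s)
        with assms show ?thesis by (simp add: second[of _ _ x])
      qed
    qed
  qed (simp_all add: assms)
  then show ?thesis by (auto simp: E_def)
qed

text \<open>The output is literally the encoding of the instance, so the assumed algorithm can be
  run on it unchanged. In row-major order, position \<open>3 + k\<close> of the output is the matrix
  entry in row \<open>k div n\<close> and column \<open>k mod n\<close>.\<close>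

lemma transduce_eq:
  "transduce lenE (entryE t) (cnf_encode (N, F)) = adjacency_encode (graph, t, N + 2 * length F + 4)"
proof -
  define R :: "nat \<Rightarrow> nat \<Rightarrow> nat" where "R i = (\<lambda>_. 0)(0 := L, 1 := i)" for i
  have len: "eval M ((\<lambda>_. 0)(0 := L)) lenE = 3 + n * n"
    by (simp add: lenE_def eval_TimesE eval_consts)
  have "eval M (R i) (entryE t) = adjacency_encode (graph, t, N + 2 * length F + 4) ! i"
    if i: "i < 3 + n * n" for i
  proof -
    define A where "A u v = (if (u, v) \<in> parcs graph then 1 else 0::nat)" for u v
    have enc: "adjacency_encode (graph, t, N + 2 * length F + 4) =
      [n, t, N + 2 * length F + 4] @ map (\<lambda>i. A (i div n) (i mod n)) [0..<n * n]"
      by (simp add: A_def Let_def concat_rows_eq[of "\<lambda>u v. if (u, v) \<in> parcs graph then 1 else 0"]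
          del: graph_simps(2))
    have R: "R i 0 = L" "R i 1 = i" by (simp_all add: R_def)
    consider "i = 0" | "i = 1" | "i = 2" | k where "i = 3 + k" "k < n * n"
      using i by (metis One_nat_def Suc_1 add_less_cancel_left le_Suc_ex less_Suc0 less_antisym not_less numeral_3_eq_3)
    then show ?thesis
    proof cases
      case 4
      have "(\<exists>u<n. \<exists>v<n. i = 3 + (u * n + v) \<and> (u, v) \<in> parcs graph) \<longleftrightarrow> (k div n, k mod n) \<in> parcs graph"
      proof
        assume "(k div n, k mod n) \<in> parcs graph"
        moreover have "k div n < n" "k mod n < n" using 4 by (simp_all add: less_mult_imp_div_less)
        moreover have "i = 3 + (k div n * n + k mod n)" using 4(1) by (simp only: div_mult_mod_eq)
        ultimately show "\<exists>u<n. \<exists>v<n. i = 3 + (u * n + v) \<and> (u, v) \<in> parcs graph" by blast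
      next
        assume "\<exists>u<n. \<exists>v<n. i = 3 + (u * n + v) \<and> (u, v) \<in> parcs graph"
        then obtain u v where "u < n" "v < n" "k = u * n + v" "(u, v) \<in> parcs graph" using 4 by auto
        moreover from this have "k div n = u" "k mod n = v" by auto
        ultimately show "(k div n, k mod n) \<in> parcs graph" by simp
      qed
      moreover have "holds M (R i) (ExE 2 sizeE (ExE 3 sizeE (AndE
          (EqE (Reg 1) (Plus (Num 3) (Plus (TimesE 11 (Reg 2) sizeE) (Reg 3)))) edgeE))) \<longleftrightarrow>
        (\<exists>u<n. \<exists>v<n. i = 3 + (u * n + v) \<and> (u, v) \<in> parcs graph)"
        using R by (simp add: eval_TimesE holds_edgeE del: graph_simps(2))
      ultimately have "eval M (R i) (entryE t) = A (k div n) (k mod n)"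
        unfolding entryE_def A_def using R 4 by (simp add: holds_def del: graph_simps(2))
      then show ?thesis unfolding enc using 4 by (simp add: nth_append)
    qed (use R in \<open>simp_all add: enc entryE_def del: adjacency_encode.simps\<close>)
  qed
  moreover have "length (adjacency_encode (graph, t, N + 2 * length F + 4)) = 3 + n * n"
    by (simp add: Let_def concat_rows_eq del: graph_simps(2))
  ultimately show ?thesis
    unfolding transduce_def unfolding M_def[symmetric] unfolding L_def[symmetric] len R_def[symmetric]
    by (intro nth_equalityI) simp_all
qed

end

section \<open>The lower bound\<close>

text \<open>Since no run is free, every valid time bound is positive; this determines the signs of
  the unknown constants.\<close>

lemma exec_cost_pos: "exec p s n s' \<Longrightarrow> 0 < n"
  by (induction rule: exec.induct) auto

text \<open>For a root \<open>b\<close> of \<open>a\<close>, Bernoulli's inequality bounds a linear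
  function of \<open>N\<close> by a multiple of \<open>b ^ N\<close>; raising this to the power
  \<open>Suc J\<close> turns \<open>b ^ N\<close> into \<open>a ^ N\<close>. The order
  \<open>Suc J\<close> keeps the root meaningful for \<open>J = 0\<close>.\<close>

lemma poly_le_exp:
  fixes a :: real
  assumes "1 < a"
  obtains D where "0 < D" "\<And>N. (2 * real N + 3) ^ J \<le> D * a ^ N"
proof -
  define b where "b = root (Suc J) a"
  have b: "1 < b" "b ^ Suc J = a" using assms by (simp_all add: b_def del: power_Suc)
  define D where "D = 2 / (b - 1) + 3"
  have D: "3 \<le> D" using b(1) by (simp add: D_def)
  have "(2 * real N + 3) ^ J \<le> D ^ Suc J * a ^ N" for N
  proof -
    have "1 + real N * (b - 1) \<le> b ^ N" using Bernoulli_inequality[of "b - 1" N] b(1) by simp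
    then have "real N \<le> b ^ N / (b - 1)" using b(1) by (simp add: field_simps)
    moreover have "1 \<le> b ^ N" using b(1) by simp
    ultimately have "2 * real N + 3 \<le> D * b ^ N" by (simp add: D_def field_simps)
    then have "(2 * real N + 3) ^ Suc J \<le> (D * b ^ N) ^ Suc J" by (intro power_mono) auto
    also have "\<dots> = D ^ Suc J * (b ^ Suc J) ^ N"
      by (simp only: power_mult_distrib power_mult[symmetric] mult.commute)
    finally have "(2 * real N + 3) ^ Suc J \<le> D ^ Suc J * a ^ N" by (simp only: b(2))
    moreover have "(2 * real N + 3) ^ J \<le> (2 * real N + 3) ^ Suc J" by (intro power_increasing) auto
    ultimately show ?thesis by linarith
  qed
  then show thesis using D by (intro that[of "D ^ Suc J"]) auto
qed

text \<open>Counts are controlled by the size, but the entry \<open>N\<close> is not, and literal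
  codes go up to \<open>2 * N - 1\<close>; hence the summand \<open>2 * N\<close>.\<close>

lemma cnf_encode_bounds:
  assumes "(N, F) \<in> cnf_instances"
  shows "length F + 2 \<le> cnf_size (N, F)"
    "\<forall>x\<in>set (cnf_encode (N, F)). x \<le> 2 * N + cnf_size (N, F) + 2"
proof -
  have C: "length C + 1 \<le> length (concat (map (\<lambda>C. length C # map lit_code C) F))" if "C \<in> set F" for C
    using that by (induction F) auto
  show "length F + 2 \<le> cnf_size (N, F)"
    by (induction F) (auto simp: cnf_size_def)
  then show "\<forall>x\<in>set (cnf_encode (N, F)). x \<le> 2 * N + cnf_size (N, F) + 2"
  proof (intro ballI)
    fix x assume F: "length F + 2 \<le> cnf_size (N, F)" and x: "x \<in> set (cnf_encode (N, F))"
    then consider "x = N" | "x = length F" | C where "C \<in> set F" "x = length C"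
      | C l where "C \<in> set F" "l \<in> set C" "x = lit_code l" by auto
    then show "x \<le> 2 * N + cnf_size (N, F) + 2"
    proof cases
      case 3
      with C show ?thesis by (fastforce simp: cnf_size_def)
    next
      case 4
      with assms have "var l < N" by (auto simp: cnf_instances_def)
      with 4 show ?thesis by (cases l) auto
    qed (use F in auto)
  qed
qed

lemma (in cnf_formula) graph_instance: "(graph, t, k) \<in> club_instances"
  using pair_graph_graph by (auto simp: club_instances_def)

lemma (in cnf_formula) graph_problem_iff:
  assumes "(N, F) \<in> cnf_instances"
    and "\<And>G k. pair_graph G \<Longrightarrow>
      problem (G, t, k) \<longleftrightarrow> (\<exists>S\<subseteq>pverts G. within_two (parcs G) S \<and> k \<le> card S)"
  shows "problem (graph, t, N + 2 * length F + 4) \<longleftrightarrow> satisfiable (N, F)"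
  unfolding assms(2)[OF pair_graph_graph] ex_within_two_graph_iff satisfiable_iff[OF assms(1)] by simp

text \<open>Treats both problems at once: the hypothesis on \<open>problem\<close> says that for
  this \<open>t\<close> it asks for a 2-club. The condition \<open>t \<le> 1\<close> keeps the
  instances in the range where the time bound is promised.\<close>

lemma not_SETH_if_solvable:
  fixes \<epsilon> :: real
  assumes "0 < \<epsilon>" and solvable: "solvable_in_time problem (2 - \<epsilon>)" and t: "t \<le> 1"
    and problem: "\<And>G k. pair_graph G \<Longrightarrow>
      problem (G, t, k) \<longleftrightarrow> (\<exists>S\<subseteq>pverts G. within_two (parcs G) S \<and> k \<le> card S)"
  shows "\<not> SETH"
proof -
  define b where "b = 2 - \<epsilon>"
  obtain p C c where p: "decides p club_instances adjacency_encode problem"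
    and "\<forall>(G, t, k)\<in>club_instances. let n = card (pverts G) in n \<ge> 1 \<and> t \<le> n \<and> k \<le> n \<longrightarrow>
      runs_within p (adjacency_encode (G, t, k)) (C * b ^ (n - k) * real n ^ c)"
    using solvable unfolding solvable_in_time_def b_def by blast
  then have time: "runs_within p (adjacency_encode (G, t, k))
        (C * b ^ (card (pverts G) - k) * real (card (pverts G)) ^ c)"
    if "(G, t, k) \<in> club_instances" "1 \<le> card (pverts G)" "t \<le> card (pverts G)"
      "k \<le> card (pverts G)" for G k
    using that by (fastforce simp: Let_def)
  \<comment> \<open>Neither sign is given. One variable and no clauses yield a graph on six
    vertices; target size 6 makes the exponent 0 and reveals the sign of \<open>C\<close>, target
    size 5 makes it 1 and reveals that of \<open>b\<close>.\<close>
  have C: "0 < C" and b: "0 < b"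
  proof -
    interpret X: cnf_formula 1 "[]" .
    have card: "card (pverts X.graph) = 6" unfolding X.graph_simps by simp
    have pos: "0 < C * b ^ (6 - k) * 6 ^ c" if "k \<le> 6" for k
    proof -
      have "runs_within p (adjacency_encode (X.graph, t, k)) (C * b ^ (6 - k) * 6 ^ c)"
        using time[OF X.graph_instance, of k, unfolded card] that t by simp
      then obtain n s where "exec p (initial (adjacency_encode (X.graph, t, k))) n s"
        "real n \<le> C * b ^ (6 - k) * 6 ^ c" unfolding runs_within_def by blast
      with exec_cost_pos[OF this(1)] show ?thesis by linarith
    qed
    from pos[of 6] show "0 < C" by (simp add: zero_less_mult_iff)
    with pos[of 5] show "0 < b" by (simp add: zero_less_mult_iff)
  qed
  \<comment> \<open>With \<open>q\<close> at least 1, the factor \<open>q ^ N\<close> is harmless on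
    the time of the reduction; \<open>r\<close> lies midway between \<open>q\<close> and 2, and the
    growth of \<open>(r / q) ^ N\<close> absorbs the polynomial in \<open>N\<close>.\<close>
  define q where "q = max b 1"
  define r where "r = (q + 2) / 2"
  have q: "1 \<le> q" "q < 2" "b \<le> q" using \<open>0 < \<epsilon>\<close> by (auto simp: q_def b_def)
  have r: "q < r" "r < 2" using q by (auto simp: r_def)
  from ex_transducer[OF _ scoped_entryE(2,1), of t] obtain K where
    K: "\<forall>B\<ge>2. \<forall>xs. length xs \<le> B \<longrightarrow> (\<forall>x\<in>set xs. x \<le> B) \<longrightarrow>
      steps (transducer lenE (entryE t) 12) (initial xs) (B ^ K) (initial (transduce lenE (entryE t) xs))"
    by auto
  let ?P = "Seq (transducer lenE (entryE t) 12) p"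
  define B where "B \<phi> = 2 * fst \<phi> + cnf_size \<phi> + 2" for \<phi> :: cnf
  have run: "\<exists>a. a \<le> B (N, F) ^ K \<and> exec (transducer lenE (entryE t) 12) (initial (cnf_encode (N, F))) a
      (initial (adjacency_encode (gadget.graph N (length F) (tautology (N, F)) (occurs (N, F)), t, N + 2 * length F + 4)))"
    if "(N, F) \<in> cnf_instances" for N F
  proof -
    have "length (cnf_encode (N, F)) \<le> B (N, F)" by (simp add: B_def cnf_size_def)
    moreover have "\<forall>x\<in>set (cnf_encode (N, F)). x \<le> B (N, F)"
      using cnf_encode_bounds(2)[OF that] by (simp add: B_def)
    moreover have "2 \<le> B (N, F)" by (simp add: B_def)
    ultimately have "steps (transducer lenE (entryE t) 12) (initial (cnf_encode (N, F))) (B (N, F) ^ K)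
      (initial (transduce lenE (entryE t) (cnf_encode (N, F))))" using K by blast
    then show ?thesis unfolding cnf_formula.transduce_eq steps_def .
  qed
  have "decides ?P cnf_instances cnf_encode satisfiable"
    unfolding decides_def
  proof
    fix \<phi> assume \<phi>: "\<phi> \<in> cnf_instances"
    obtain N F where NF: "\<phi> = (N, F)" by (cases \<phi>)
    interpret X: cnf_formula N F .
    from run \<phi> NF obtain a where a: "exec (transducer lenE (entryE t) 12) (initial (cnf_encode \<phi>)) a
      (initial (adjacency_encode (X.graph, t, N + 2 * length F + 4)))" by blast
    from p X.graph_instance obtain n s where
      "exec p (initial (adjacency_encode (X.graph, t, N + 2 * length F + 4))) n s"
      "fst s 0 \<noteq> 0 \<longleftrightarrow> problem (X.graph, t, N + 2 * length F + 4)"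
      unfolding decides_def by blast
    with exec.Seq[OF a this(1)] X.graph_problem_iff[OF _ problem] \<phi> NF
    show "\<exists>n s. exec ?P (initial (cnf_encode \<phi>)) n s \<and> (fst s 0 \<noteq> 0 \<longleftrightarrow> satisfiable \<phi>)"
      by blast
  qed
  moreover obtain D where D: "0 < D" "\<And>N. (2 * real N + 3) ^ (K + c) \<le> D * (r / q) ^ N"
    using poly_le_exp[of "r / q" "K + c"] r q by auto
  have "runs_within ?P (cnf_encode \<phi>) ((1 + C * 2 ^ c) * D * r ^ fst \<phi> * real (cnf_size \<phi>) ^ (K + c))"
    if \<phi>: "\<phi> \<in> cnf_instances" for \<phi>
  proof -
    obtain N F where NF: "\<phi> = (N, F)" by (cases \<phi>)
    interpret X: cnf_formula N F .
    let ?n = "2 * N + 2 * length F + 4"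
    let ?L = "real (cnf_size \<phi>)"
    from run \<phi> NF obtain a where a: "a \<le> B \<phi> ^ K"
      "exec (transducer lenE (entryE t) 12) (initial (cnf_encode \<phi>)) a
      (initial (adjacency_encode (X.graph, t, N + 2 * length F + 4)))" by blast
    have "runs_within p (adjacency_encode (X.graph, t, N + 2 * length F + 4)) (C * b ^ N * real ?n ^ c)"
      using time[OF X.graph_instance, of "N + 2 * length F + 4"] t by simp
    then obtain n s where n: "exec p (initial (adjacency_encode (X.graph, t, N + 2 * length F + 4))) n s"
      "real n \<le> C * b ^ N * real ?n ^ c" unfolding runs_within_def by blast
    have size: "real (length F) + 2 \<le> ?L" using cnf_encode_bounds(1) \<phi> NF by fastforce
    define S where "S = real (B \<phi>)"
    have S: "S = 2 * real N + ?L + 2" by (simp add: S_def B_def NF)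
    have S1: "1 \<le> S" using S by simp
    have bq: "b ^ N \<le> q ^ N" using b q by (intro power_mono) auto
    have q1: "1 \<le> q ^ N" using q by simp
    have pos: "0 \<le> q ^ N * S ^ (K + c)" using q S1 by simp
    have "real a \<le> S ^ K" unfolding S_def using a(1) by (simp flip: of_nat_power)
    also have "\<dots> \<le> S ^ (K + c)" using S1 by (intro power_increasing) auto
    also have "\<dots> \<le> q ^ N * S ^ (K + c)" using q1 S1 by simp
    finally have 1: "real a \<le> q ^ N * S ^ (K + c)" .
    have "real ?n ^ c \<le> (2 * S) ^ c" using S size by (intro power_mono) auto
    also have "\<dots> \<le> 2 ^ c * S ^ (K + c)"
      unfolding power_mult_distrib using S1 by (intro mult_left_mono power_increasing) auto
    finally have "C * b ^ N * real ?n ^ c \<le> C * q ^ N * (2 ^ c * S ^ (K + c))"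
      using C b bq q1 by (intro mult_mono) auto
    with n(2) 1 have "real (a + n) \<le> (1 + C * 2 ^ c) * (q ^ N * S ^ (K + c))"
      by (simp add: algebra_simps)
    also have "\<dots> \<le> (1 + C * 2 ^ c) * (q ^ N * ((D * (r / q) ^ N) * ?L ^ (K + c)))"
    proof (intro mult_left_mono)
      \<comment> \<open>A sum of \<open>N\<close> and the size is split into a product, which is
        possible because the size is at least 2; only the factor \<open>2 * N + 3\<close> then has
        to be absorbed by the exponential.\<close>
      have "2 * real N * 1 \<le> 2 * real N * ?L" using size by (intro mult_left_mono) auto
      then have "S \<le> (2 * real N + 3) * ?L" using S size by (simp add: algebra_simps)
      then have "S ^ (K + c) \<le> ((2 * real N + 3) * ?L) ^ (K + c)" using S1 by (intro power_mono) auto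
      also have "\<dots> \<le> (D * (r / q) ^ N) * ?L ^ (K + c)"
        unfolding power_mult_distrib[of _ ?L] using D(2) by (intro mult_right_mono) auto
      finally show "S ^ (K + c) \<le> (D * (r / q) ^ N) * ?L ^ (K + c)" .
    qed (use C q in auto)
    also have "\<dots> = (1 + C * 2 ^ c) * D * r ^ fst \<phi> * ?L ^ (K + c)"
      using q by (simp add: power_divide NF)
    finally show ?thesis
      unfolding runs_within_def using exec.Seq[OF a(2) n(1)] by blast
  qed
  moreover have "r = 2 - (2 - r)" "0 < 2 - r" using r by auto
  ultimately show ?thesis unfolding SETH_def by metis
qed

theorem theorem4:
  assumes SETH
  shows "\<not> (\<exists>\<epsilon>::real. \<epsilon> > 0 \<and> solvable_in_time robust_two_club_problem (2 - \<epsilon>)) \<and>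
    \<not> (\<exists>\<epsilon>::real. \<epsilon> > 0 \<and> solvable_in_time hereditary_two_club_problem (2 - \<epsilon>))"
proof -
  have "robust_two_club_problem (G, 1, k) \<longleftrightarrow> (\<exists>S\<subseteq>pverts G. within_two (parcs G) S \<and> k \<le> card S)"
    if "pair_graph G" for G k
    using robust_two_club_1_iff[OF that] by auto
  moreover have "hereditary_two_club_problem (G, 0, k) \<longleftrightarrow>
      (\<exists>S\<subseteq>pverts G. within_two (parcs G) S \<and> k \<le> card S)"
    if "pair_graph G" for G k
    using hereditary_two_club_0_iff[OF that] by auto
  ultimately show ?thesis
    using assms not_SETH_if_solvable[of _ robust_two_club_problem 1]
      not_SETH_if_solvable[of _ hereditary_two_club_problem 0] by blast
qed

end
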